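(* Let $s$ be a positive integer not divisible by $4$, let $m\ge 3$ be an odd integer, let $n=sm$, and let $\Gamma=C_n[mK_1]$. Then $\Gamma$ is the skeleton of (1) a chiral polytopal map of type $\{mn,2m\}$ on an orientable surface of genus $1+m\left(n\frac{m-1}{2}-1\right)$; (2) an orientable reflexible polytopal map of type $\{n,2m\}$ on an orientable surface of genus $1+m\left(n\frac{m-1}{2}-m\right)$; (3) a non-orientable reflexible polytopal map of type $\{2n,2m\}$ on a non-orientable surface of (non-orientable) genus $2+m\left(n(m-1)-m\right)$.
   Context: A map is a finite connected graph (its skeleton), viewed as a 1-dimensional CW complex, embedded in a closed surface so that every connected component of the complement (a face) is homeomorphic to an open disk. The map is polytopal if the boundary of each face is a cycle of the skeleton and every edge lies on the boundary of exactly two distinct faces. An automorphism of a map is an automorphism of the skeleton that extends to a homeomorphism of the surface; these form the group $\mathrm{Aut}(\mathcal M)$. A map is rotary if the stabiliser of each vertex contains a cyclic group acting transitively on the edges incident to it, and the stabiliser of each face contains a cyclic group acting transitively on the vertices (and edges) of the face. A rotary map has type $\{p,q\}$ if each face has $p$ edges on its boundary and the skeleton is $q$-valent. A rotary map is reflexible if the stabiliser of a face also contains an automorphism acting as a reflection of that face; a reflexible map is orientable or non-orientable according to its surface; a rotary map on an orientable surface that is not reflexible is called chiral. Genus: an orientable surface of Euler characteristic $\chi$ has genus $(2-\chi)/2$; a non-orientable surface of Euler characteristic $\chi$ has (non-orientable) genus $2-\chi$. The graph $C_n[mK_1]$ (lexicographic product of the $n$-cycle with the edgeless graph on $m$ vertices)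 has vertex set $\{1,\dots,n\}\times\{1,\dots,m\}$, with $(i_1,j_1)$ adjacent to $(i_2,j_2)$ if and only if $i_1\equiv i_2\pm1 \pmod n$. *)

theory Defs
  imports Main
begin

text \<open>Maps on closed surfaces are encoded combinatorially by their flag systems:
  a finite set of flags with three fixed-point-free involutions r0, r1, r2
  (r0 r2 = r2 r0 fixed-point-free) generating a group acting transitively.
  Vertices, edges, faces are the orbits of the subgroups generated by
  (r1,r2), (r0,r2), (r0,r1) respectively.\<close>

record 'f fmap =
  flg :: "'f set"
  rz :: "'f \<Rightarrow> 'f"
  ro :: "'f \<Rightarrow> 'f"
  rt :: "'f \<Rightarrow> 'f"

definition fmap_wf :: "'f fmap \<Rightarrow> bool" where
  "fmap_wf M \<longleftrightarrow> finite (flg M) \<and> flg M \<noteq> {} \<and>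
     (\<forall>x\<in>flg M.
        rz M x \<in> flg M \<and> ro M x \<in> flg M \<and> rt M x \<in> flg M \<and>
        rz M (rz M x) = x \<and> ro M (ro M x) = x \<and> rt M (rt M x) = x \<and>
        rz M x \<noteq> x \<and> ro M x \<noteq> x \<and> rt M x \<noteq> x \<and>
        rz M (rt M x) = rt M (rz M x) \<and> rz M (rt M x) \<noteq> x) \<and>
     (\<forall>x\<in>flg M. \<forall>y\<in>flg M.
        (x, y) \<in> ({(z, rz M z) | z. z \<in> flg M} \<union> {(z, ro M z) | z. z \<in> flg M}
                   \<union> {(z, rt M z) | z. z \<in> flg M})\<^sup>*)"

definition vorb :: "'f fmap \<Rightarrow> 'f \<Rightarrow> 'f set" where
  "vorb M x = {y. (x, y) \<in> ({(z, ro M z) | z. z \<in> flg M} \<union> {(z, rt M z) | z. z \<in> flg M})\<^sup>*}"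

definition eorb :: "'f fmap \<Rightarrow> 'f \<Rightarrow> 'f set" where
  "eorb M x = {y. (x, y) \<in> ({(z, rz M z) | z. z \<in> flg M} \<union> {(z, rt M z) | z. z \<in> flg M})\<^sup>*}"

definition forb :: "'f fmap \<Rightarrow> 'f \<Rightarrow> 'f set" where
  "forb M x = {y. (x, y) \<in> ({(z, rz M z) | z. z \<in> flg M} \<union> {(z, ro M z) | z. z \<in> flg M})\<^sup>*}"

definition mverts :: "'f fmap \<Rightarrow> 'f set set" where
  "mverts M = vorb M ` flg M"
definition medges :: "'f fmap \<Rightarrow> 'f set set" where
  "medges M = eorb M ` flg M"
definition mfaces :: "'f fmap \<Rightarrow> 'f set set" where
  "mfaces M = forb M ` flg M"

text \<open>Euler characteristic of the underlying surface.\<close>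
definition euler_char :: "'f fmap \<Rightarrow> int" where
  "euler_char M = int (card (mverts M)) - int (card (medges M)) + int (card (mfaces M))"

text \<open>The surface is orientable iff the flag graph is bipartite.\<close>
definition orientable :: "'f fmap \<Rightarrow> bool" where
  "orientable M \<longleftrightarrow> (\<exists>c :: 'f \<Rightarrow> bool. \<forall>x\<in>flg M.
      c (rz M x) \<noteq> c x \<and> c (ro M x) \<noteq> c x \<and> c (rt M x) \<noteq> c x)"

text \<open>Vertices and edges lying on the boundary of a face; edges incident to a vertex.\<close>
definition face_verts :: "'f fmap \<Rightarrow> 'f set \<Rightarrow> 'f set set" where
  "face_verts M Fa = vorb M ` Fa"
definition face_edges :: "'f fmap \<Rightarrow> 'f set \<Rightarrow> 'f set set" where
  "face_edges M Fa = eorb M ` Fa"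
definition vert_edges :: "'f fmap \<Rightarrow> 'f set \<Rightarrow> 'f set set" where
  "vert_edges M v = eorb M ` v"

text \<open>Skeleton: vertex u adjacent to w iff some edge joins them.\<close>
definition skel_adj :: "'f fmap \<Rightarrow> 'f set \<Rightarrow> 'f set \<Rightarrow> bool" where
  "skel_adj M u w \<longleftrightarrow> (\<exists>x\<in>flg M. vorb M x = u \<and> vorb M (rz M x) = w)"

text \<open>The skeleton is a simple graph (no loops, no multiple edges).\<close>
definition simple_skeleton :: "'f fmap \<Rightarrow> bool" where
  "simple_skeleton M \<longleftrightarrow>
     (\<forall>x\<in>flg M. vorb M x \<noteq> vorb M (rz M x)) \<and>
     (\<forall>x\<in>flg M. \<forall>y\<in>flg M.
        {vorb M x, vorb M (rz M x)} = {vorb M y, vorb M (rz M y)} \<longrightarrow> eorb M x = eorb M y)"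

text \<open>Polytopal: each face boundary is a cycle of the skeleton (closed walk of
  length = half the number of flags of the face, of length at least 3, without repeated
  vertices) and every edge lies on two distinct faces.\<close>
definition polytopal :: "'f fmap \<Rightarrow> bool" where
  "polytopal M \<longleftrightarrow>
     (\<forall>Fa\<in>mfaces M. 2 * card (face_verts M Fa) = card Fa \<and>
                    2 * card (face_edges M Fa) = card Fa \<and> card Fa \<ge> 6) \<and>
     (\<forall>x\<in>flg M. forb M x \<noteq> forb M (rt M x))"

text \<open>Type {p,q}: every face has p edges, every vertex is q-valent.\<close>
definition map_type :: "'f fmap \<Rightarrow> nat \<Rightarrow> nat \<Rightarrow> bool" where
  "map_type M p q \<longleftrightarrow> (\<forall>Fa\<in>mfaces M. card (face_edges M Fa) = p) \<and>
                      (\<forall>v\<in>mverts M. card (vert_edges M v) = q)"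

text \<open>Automorphisms: permutations of the flags commuting with the involutions.\<close>
definition map_aut :: "'f fmap \<Rightarrow> ('f \<Rightarrow> 'f) \<Rightarrow> bool" where
  "map_aut M a \<longleftrightarrow> bij_betw a (flg M) (flg M) \<and>
     (\<forall>x\<in>flg M. a (rz M x) = rz M (a x) \<and> a (ro M x) = ro M (a x) \<and> a (rt M x) = rt M (a x))"

definition rotary :: "'f fmap \<Rightarrow> bool" where
  "rotary M \<longleftrightarrow>
     (\<forall>v\<in>mverts M. \<exists>a. map_aut M a \<and> a ` v = v \<and>
         (\<forall>e1\<in>vert_edges M v. \<forall>e2\<in>vert_edges M v. \<exists>k. (a ^^ k) ` e1 = e2)) \<and>
     (\<forall>Fa\<in>mfaces M. \<exists>a. map_aut M a \<and> a ` Fa = Fa \<and>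
         (\<forall>v1\<in>face_verts M Fa. \<forall>v2\<in>face_verts M Fa. \<exists>k. (a ^^ k) ` v1 = v2) \<and>
         (\<forall>e1\<in>face_edges M Fa. \<forall>e2\<in>face_edges M Fa. \<exists>k. (a ^^ k) ` e1 = e2))"

text \<open>An automorphism stabilising face Fa acts on its flags as an element of the dihedral
  group generated by r0, r1; it acts as a reflection of the face iff it sends some flag x
  of Fa to a flag (r0 r1)^k r1 x, i.e. it reverses the orientation of the face.\<close>
definition reflects_face :: "'f fmap \<Rightarrow> ('f \<Rightarrow> 'f) \<Rightarrow> 'f set \<Rightarrow> bool" where
  "reflects_face M a Fa \<longleftrightarrow> a ` Fa = Fa \<and>
     (\<exists>x\<in>Fa. \<exists>k. a x = ((rz M \<circ> ro M) ^^ k) (ro M x))"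

definition reflexible :: "'f fmap \<Rightarrow> bool" where
  "reflexible M \<longleftrightarrow> rotary M \<and>
     (\<forall>Fa\<in>mfaces M. \<exists>a. map_aut M a \<and> reflects_face M a Fa)"

definition chiral :: "'f fmap \<Rightarrow> bool" where
  "chiral M \<longleftrightarrow> rotary M \<and> orientable M \<and> \<not> reflexible M"

text \<open>The graph C_n[mK_1] on {0..<n} x {0..<m}.\<close>
definition lexcyc_adj :: "nat \<Rightarrow> nat \<Rightarrow> nat \<times> nat \<Rightarrow> nat \<times> nat \<Rightarrow> bool" where
  "lexcyc_adj n m u w \<longleftrightarrow> fst u < n \<and> snd u < m \<and> fst w < n \<and> snd w < m \<and>
     ((fst u + 1) mod n = fst w \<or> (fst w + 1) mod n = fst u)"

text \<open>The skeleton of M is (isomorphic to) the simple graph with vertex set V and adjacency A.\<close>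
definition skeleton_is :: "'f fmap \<Rightarrow> 'v set \<Rightarrow> ('v \<Rightarrow> 'v \<Rightarrow> bool) \<Rightarrow> bool" where
  "skeleton_is M V A \<longleftrightarrow> simple_skeleton M \<and>
     (\<exists>h. bij_betw h (mverts M) V \<and>
          (\<forall>u\<in>mverts M. \<forall>w\<in>mverts M. skel_adj M u w \<longleftrightarrow> A (h u) (h w)))"

end

theory Submission
  imports Defs "HOL-Library.Countable"
begin

text \<open>Label the vertices of $C_n[mK_1]$ by $(i,j)$ with $i$ unrolled to the integers and $j$ taken modulo
  $m$, and let the faces run once through each fibre per turn around the cycle: a face is a sequence $(j_i)$ with
  $j_{i+1} = t j_i - j_{i-1} \pm 1$, the sign being constant along the face. Around a vertex the two
  signs alternate, and the $2m$ edges are cyclically ordered because $m$ is odd. Closing up by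
  $(i+n, j) \sim (i, \chi j + \tau)$ with $\chi = \pm 1$, where $\chi = -1$ also swaps the signs, gives
  the three maps: $(t,\chi,\tau) = (2,1,1)$ is the chiral map, $(2,1,0)$ the orientable reflexible
  map, and $(-2,-1,0)$ for $n$ odd, $(0,-1,0)$ for $n \equiv 2$ modulo $4$, the non-orientable one.
  The translation of $i$, the rotation $(i,j) \mapsto (-i,-j)$ and the addition of solutions of the
  homogeneous recurrence act transitively on the flags of each orientation class, and for
  $\tau = 0$ the reflection $j \mapsto -j$ exchanges the two classes. For $\tau = 1$ going once around
  a face adds $1$ to $j$, whereas the vertex rotations add $\pm 1$ according to the class, so that
  no automorphism exchanges the classes.\<close>

section \<open>Orbits of two involutions\<close>

text \<open>The homogeneous recurrence has the transfer matrix A = ((t, -1), (1, 0)), and its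
  solutions descend to the quotient precisely when A^n = \<chi> modulo m. For t = 2 the matrix
  satisfies (A - 1)^2 = 0, so A^n = 1 + n (A - 1) = 1, because m divides n. For \<chi> = -1, either
  t = -2, where -A is unipotent and A^n = (-1)^n, or t = 0, where A^2 = -1; these serve n odd and n
  = 2 modulo 4. As m is odd, the remaining case 4 | n is the excluded case 4 | s. The translation by
  \<tau> respects the inhomogeneous recurrence because t \<tau> = 2 \<tau>, which for \<tau> = 1
  means t = 2. Face lengths come from a single face. For t = 2 the values i (i - 1) / 2 have period
  m modulo m, so a face closes after one turn around the cycle if \<tau> = 0 and after m turns if
  \<tau> = 1. For \<chi> = -1 there is a constant face d with (2 - t) d = 1 modulo m, where 2 - t is
  4 or 2 and thus a unit; after one turn it returns as -d, so it closes after two turns.\<close>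

definition orb2 :: "'f set \<Rightarrow> ('f \<Rightarrow> 'f) \<Rightarrow> ('f \<Rightarrow> 'f) \<Rightarrow> 'f \<Rightarrow> 'f set" where
  "orb2 F f g x = {y. (x, y) \<in> ({(z, f z) | z. z \<in> F} \<union> {(z, g z) | z. z \<in> F})\<^sup>*}"

definition involution_on :: "'f set \<Rightarrow> ('f \<Rightarrow> 'f) \<Rightarrow> bool" where
  "involution_on F f \<longleftrightarrow> (\<forall>x\<in>F. f x \<in> F \<and> f (f x) = x)"

lemma vorb_eq: "vorb M = orb2 (flg M) (ro M) (rt M)"
  and eorb_eq: "eorb M = orb2 (flg M) (rz M) (rt M)"
  and forb_eq: "forb M = orb2 (flg M) (rz M) (ro M)"
  by (auto simp: fun_eq_iff vorb_def eorb_def forb_def orb2_def)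

lemma orb2_self [simp]: "x \<in> orb2 F f g x"
  by (simp add: orb2_def)

lemma orb2_induct [consumes 1, case_names base left right]:
  assumes "y \<in> orb2 F f g x" "P x"
    and "\<And>z. z \<in> F \<Longrightarrow> z \<in> orb2 F f g x \<Longrightarrow> P z \<Longrightarrow> P (f z)"
    and "\<And>z. z \<in> F \<Longrightarrow> z \<in> orb2 F f g x \<Longrightarrow> P z \<Longrightarrow> P (g z)"
  shows "P y"
proof -
  have "(x, y) \<in> ({(z, f z) | z. z \<in> F} \<union> {(z, g z) | z. z \<in> F})\<^sup>*"
    using assms(1) by (simp add: orb2_def)
  then show ?thesis
  proof (induction rule: rtrancl_induct)
    case base
    show ?case by (rule assms(2))
  next
    case (step y z)
    have "y \<in> orb2 F f g x" using step(1) by (simp add: orb2_def)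
    then show ?case using step(2,3) assms(3)[of y] assms(4)[of y] by auto
  qed
qed

lemma orb2_step:
  assumes "y \<in> orb2 F f g x" "y \<in> F"
  shows "f y \<in> orb2 F f g x" "g y \<in> orb2 F f g x"
  using assms unfolding orb2_def by (auto intro: rtrancl.rtrancl_into_rtrancl)

lemma orb2_trans:
  assumes "y \<in> orb2 F f g x" "z \<in> orb2 F f g y"
  shows "z \<in> orb2 F f g x"
  using assms unfolding orb2_def by auto

context
  fixes F :: "'f set" and f g :: "'f \<Rightarrow> 'f"
  assumes f: "involution_on F f" and g: "involution_on F g"
begin

lemma orb2_subset: "x \<in> F \<Longrightarrow> orb2 F f g x \<subseteq> F"
proof
  fix y assume "x \<in> F" and "y \<in> orb2 F f g x"
  from this(2,1) show "y \<in> F"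
    by (induction rule: orb2_induct) (use f g in \<open>auto simp: involution_on_def\<close>)
qed

lemma orb2_sym:
  assumes "x \<in> F" "y \<in> orb2 F f g x"
  shows "x \<in> orb2 F f g y"
  using assms(2)
proof (induction rule: orb2_induct)
  case base
  show ?case by simp
next
  case (left z)
  have "z \<in> orb2 F f g (f z)"
    using orb2_step(1)[of "f z" F f g "f z"] left f by (auto simp: involution_on_def)
  then show ?case using left by (blast intro: orb2_trans)
next
  case (right z)
  have "z \<in> orb2 F f g (g z)"
    using orb2_step(2)[of "g z" F f g "g z"] right g by (auto simp: involution_on_def)
  then show ?case using right by (blast intro: orb2_trans)
qed

lemma orb2_eq_iff:
  assumes "x \<in> F"
  shows "orb2 F f g y = orb2 F f g x \<longleftrightarrow> y \<in> orb2 F f g x"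
proof
  assume "y \<in> orb2 F f g x"
  then show "orb2 F f g y = orb2 F f g x"
    using orb2_sym[OF assms] orb2_trans[of _ F f g] by (metis subsetI subset_antisym)
next
  assume "orb2 F f g y = orb2 F f g x"
  then show "y \<in> orb2 F f g x" using orb2_self[of y F f g] by simp
qed

lemma orb2_left: "x \<in> F \<Longrightarrow> orb2 F f g (f x) = orb2 F f g x"
  by (simp add: orb2_eq_iff orb2_step)

lemma orb2_right: "x \<in> F \<Longrightarrow> orb2 F f g (g x) = orb2 F f g x"
  by (simp add: orb2_eq_iff orb2_step)

lemma card_orb2_partition:
  assumes "finite F" "\<And>x. x \<in> F \<Longrightarrow> card (orb2 F f g x) = k"
  shows "k * card (orb2 F f g ` F) = card F"
proof -
  have "\<Union>(orb2 F f g ` F) = F"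
  proof
    show "\<Union>(orb2 F f g ` F) \<subseteq> F" using orb2_subset by blast
    show "F \<subseteq> \<Union>(orb2 F f g ` F)" using orb2_self by fast
  qed
  moreover have "k * card (orb2 F f g ` F) = card (\<Union>(orb2 F f g ` F))"
  proof (rule card_partition)
    show "finite (orb2 F f g ` F)" using assms(1) by simp
    show "finite (\<Union>(orb2 F f g ` F))" using assms(1) calculation by metis
    show "card A = k" if "A \<in> orb2 F f g ` F" for A using that assms(2) by auto
    fix A B assume "A \<in> orb2 F f g ` F" "B \<in> orb2 F f g ` F" "A \<noteq> B"
    then obtain x y where xy: "x \<in> F" "A = orb2 F f g x" "y \<in> F" "B = orb2 F f g y" by auto
    show "A \<inter> B = {}"
    proof (rule ccontr)
      assume "A \<inter> B \<noteq> {}"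
      then obtain z where "z \<in> A" "z \<in> B" by auto
      then show False using xy \<open>A \<noteq> B\<close> orb2_eq_iff[of x z] orb2_eq_iff[of y z] by simp
    qed
  qed
  ultimately show ?thesis by simp
qed

lemma orb2_image:
  assumes "a ` F \<subseteq> F" "\<And>z. z \<in> F \<Longrightarrow> a (f z) = f (a z)" "\<And>z. z \<in> F \<Longrightarrow> a (g z) = g (a z)"
    and "x \<in> F"
  shows "a ` orb2 F f g x = orb2 F f g (a x)"
proof
  show "a ` orb2 F f g x \<subseteq> orb2 F f g (a x)"
  proof clarify
    fix y assume "y \<in> orb2 F f g x"
    then show "a y \<in> orb2 F f g (a x)"
      by (induction rule: orb2_induct) (use assms in \<open>auto intro: orb2_step\<close>)
  qed
  show "orb2 F f g (a x) \<subseteq> a ` orb2 F f g x"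
  proof
    fix y assume "y \<in> orb2 F f g (a x)"
    then show "y \<in> a ` orb2 F f g x"
    proof (induction rule: orb2_induct)
      case base
      show ?case by simp
    next
      case (left z)
      then obtain w where "w \<in> orb2 F f g x" "z = a w" by auto
      then show ?case using orb2_subset[OF \<open>x \<in> F\<close>] assms(2)[of w] orb2_step(1)[of w F f g x]
        by (metis image_eqI subsetD)
    next
      case (right z)
      then obtain w where "w \<in> orb2 F f g x" "z = a w" by auto
      then show ?case using orb2_subset[OF \<open>x \<in> F\<close>] assms(3)[of w] orb2_step(2)[of w F f g x]
        by (metis image_eqI subsetD)
    qed
  qed
qed

text \<open>This supplies the cyclic groups in \<open>rotary\<close>. At \<open>x\<close> the map
  \<open>a\<close> acts as the rotation \<open>f\<close> after \<open>g\<close>, and it commutes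
  with both, so its powers carry \<open>x\<close> and \<open>g x\<close> to all flags of the orbit.
  Because one of the two involutions preserves labels, the images of \<open>x\<close> alone already
  show every label.\<close>

lemma cyclic_on_orbit_labels:
  fixes L :: "'f \<Rightarrow> 'f set"
  assumes fin: "finite F" and a: "bij_betw a F F"
    and cf: "\<And>z. z \<in> F \<Longrightarrow> a (f z) = f (a z)" and cg: "\<And>z. z \<in> F \<Longrightarrow> a (g z) = g (a z)"
    and x: "x \<in> F" and ax: "a x = f (g x)"
    and L: "\<And>z. z \<in> F \<Longrightarrow> L (a z) = a ` L z"
    and Lg: "(\<forall>z\<in>F. L (g z) = L z) \<or> (\<forall>z\<in>F. L (f z) = L z)"
    and e: "e1 \<in> L ` orb2 F f g x" "e2 \<in> L ` orb2 F f g x"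
  shows "\<exists>k. (a ^^ k) ` e1 = e2"
proof -
  have aF: "z \<in> F \<Longrightarrow> a z \<in> F" for z using a by (auto simp: bij_betw_def)
  have pF: "z \<in> F \<Longrightarrow> (a ^^ k) z \<in> F" for z k by (induction k) (auto simp: aF)
  have fF: "z \<in> F \<Longrightarrow> f z \<in> F" "z \<in> F \<Longrightarrow> g z \<in> F"
    and ff: "z \<in> F \<Longrightarrow> f (f z) = z" "z \<in> F \<Longrightarrow> g (g z) = z" for z
    using f g by (auto simp: involution_on_def)
  have pf: "z \<in> F \<Longrightarrow> (a ^^ k) (f z) = f ((a ^^ k) z)" for z k
    by (induction k) (auto simp: cf pF)
  have pg: "z \<in> F \<Longrightarrow> (a ^^ k) (g z) = g ((a ^^ k) z)" for z k
    by (induction k) (auto simp: cg pF)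
  have Lp: "z \<in> F \<Longrightarrow> L ((a ^^ k) z) = (a ^^ k) ` L z" for z k
    by (induction k) (auto simp: L pF image_image)
  \<comment> \<open>\<open>rotary\<close> offers only non-negative powers, so a return time
    \<open>N\<close> of \<open>x\<close> is found by pigeonhole, and \<open>N - 1\<close> then
    serves as the exponent -1.\<close>
  obtain N where N: "N > 0" "(a ^^ N) x = x"
  proof -
    have "\<not> inj_on (\<lambda>k. (a ^^ k) x) UNIV"
    proof
      assume "inj_on (\<lambda>k. (a ^^ k) x) UNIV"
      moreover have "range (\<lambda>k. (a ^^ k) x) \<subseteq> F" using pF x by auto
      ultimately show False using fin by (meson finite_imageD finite_subset infinite_UNIV_nat)
    qed
    then obtain j k where "j \<noteq> k" "(a ^^ j) x = (a ^^ k) x" by (auto simp: inj_on_def)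
    then obtain j k where jk: "j < k" "(a ^^ j) x = (a ^^ k) x" by (metis nat_neq_iff)
    have inj: "u \<in> F \<Longrightarrow> v \<in> F \<Longrightarrow> (a ^^ j) u = (a ^^ j) v \<Longrightarrow> u = v" for u v
    proof (induction j)
      case (Suc j)
      have "(a ^^ j) u = (a ^^ j) v"
        using Suc.prems pF[of u j] pF[of v j] a by (auto simp: bij_betw_def inj_on_def)
      then show ?case using Suc by blast
    qed simp
    have "(a ^^ j) ((a ^^ (k - j)) x) = (a ^^ j) x"
      using jk by (simp flip: comp_apply[of "a ^^ j"] funpow_add)
    then have "(a ^^ (k - j)) x = x" using inj pF x by blast
    then show ?thesis using that[of "k - j"] jk by simp
  qed
  have Nk: "(a ^^ (N * k)) x = x" for k
    by (induction k) (simp_all add: funpow_add N(2))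
  \<comment> \<open>\<open>a\<close> takes \<open>f x\<close> to \<open>f (f (g x)) = g x\<close>,
    so \<open>f x\<close> is the preimage of \<open>g x\<close> under \<open>a\<close>.\<close>
  have fx: "f x = (a ^^ (N - 1)) (g x)"
  proof -
    have "a (f x) = g x" using cf[OF x] ax ff(1)[OF fF(2)[OF x]] by simp
    moreover have "(a ^^ N) (f x) = f x" using pf[OF x] N(2) by simp
    moreover have "(a ^^ N) (f x) = (a ^^ (N - 1)) (a (f x))"
      using N(1) by (cases N) (simp_all add: funpow_swap1)
    ultimately show ?thesis by simp
  qed
  have orb: "\<exists>k. y = (a ^^ k) x \<or> y = (a ^^ k) (g x)" if "y \<in> orb2 F f g x" for y
    using that
  proof (induction rule: orb2_induct)
    case base
    have "x = (a ^^ 0) x" by simp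
    then show ?case by blast
  next
    case (left z)
    then obtain k where "z = (a ^^ k) x \<or> z = (a ^^ k) (g x)" by blast
    then show ?case
    proof
      assume "z = (a ^^ k) x"
      then have "f z = (a ^^ (k + (N - 1))) (g x)" using pf[OF x] fx by (simp add: funpow_add)
      then show ?case by blast
    next
      assume "z = (a ^^ k) (g x)"
      then have "f z = (a ^^ (k + 1)) x" using pf[OF fF(2)[OF x]] ax by (simp add: funpow_swap1)
      then show ?case by blast
    qed
  next
    case (right z)
    then obtain k where "z = (a ^^ k) x \<or> z = (a ^^ k) (g x)" by blast
    then have "g z = (a ^^ k) (g x) \<or> g z = (a ^^ k) x"
      using pg[OF x, of k] pg[OF fF(2)[OF x], of k] ff(2)[OF x] by auto
    then show ?case by blast
  qed
  have lab: "\<exists>k. e = L ((a ^^ k) x)" if e': "e \<in> L ` orb2 F f g x" for e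
  proof -
    obtain y where y: "y \<in> orb2 F f g x" "e = L y" using e' by auto
    from orb[OF y(1)] obtain k where "y = (a ^^ k) x \<or> y = (a ^^ k) (g x)" by blast
    moreover have "\<exists>l. L ((a ^^ k) (g x)) = L ((a ^^ l) x)"
      using Lg
    proof
      assume "\<forall>z\<in>F. L (g z) = L z"
      then have "L ((a ^^ k) (g x)) = L ((a ^^ k) x)" using pg[OF x] pF[OF x] by simp
      then show ?thesis by blast
    next
      assume *: "\<forall>z\<in>F. L (f z) = L z"
      have "L ((a ^^ k) (g x)) = L (f ((a ^^ k) (g x)))" using * pF fF(2)[OF x] by simp
      also have "f ((a ^^ k) (g x)) = (a ^^ (k + 1)) x"
        using pf[OF fF(2)[OF x]] ax by (simp add: funpow_swap1)
      finally show ?thesis by blast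
    qed
    ultimately show ?thesis using y(2) by auto
  qed
  obtain k1 k2 where k: "e1 = L ((a ^^ k1) x)" "e2 = L ((a ^^ k2) x)" using lab[OF e(1)] lab[OF e(2)] by auto
  \<comment> \<open>Each of the \<open>k1\<close> rotations is undone by \<open>N - 1\<close>
    further ones; then \<open>k2\<close> rotations are applied.\<close>
  have "(a ^^ (k2 + (N - 1) * k1)) ` e1 = L ((a ^^ (k2 + (N - 1) * k1)) ((a ^^ k1) x))"
    using k Lp[OF pF[OF x]] by simp
  also have "(a ^^ (k2 + (N - 1) * k1)) ((a ^^ k1) x) = (a ^^ (k2 + N * k1)) x"
  proof -
    have "N * k1 = (N - 1) * k1 + k1" using N(1) by (cases N) auto
    then show ?thesis by (simp add: funpow_add)
  qed
  also have "\<dots> = (a ^^ k2) x" by (simp add: funpow_add Nk)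
  finally show ?thesis using k by blast
qed

end

section \<open>Flag systems\<close>

definition aut_eq :: "'f fmap \<Rightarrow> 'f \<Rightarrow> 'f \<Rightarrow> bool" where
  "aut_eq M x y \<longleftrightarrow> (\<exists>a. map_aut M a \<and> a x = y)"

lemma map_aut_flg: "map_aut M a \<Longrightarrow> x \<in> flg M \<Longrightarrow> a x \<in> flg M"
  by (auto simp: map_aut_def bij_betw_def)

lemma map_aut_comp: "map_aut M a \<Longrightarrow> map_aut M b \<Longrightarrow> map_aut M (b \<circ> a)"
  using map_aut_flg[of M a] unfolding map_aut_def by (auto intro: bij_betw_trans)

lemma aut_eq_trans: "aut_eq M x y \<Longrightarrow> aut_eq M y z \<Longrightarrow> aut_eq M x z"
  unfolding aut_eq_def using map_aut_comp by (metis comp_apply)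

locale flag_map =
  fixes M :: "'f fmap"
  assumes wf: "fmap_wf M"
begin

lemma invol: "involution_on (flg M) (rz M)" "involution_on (flg M) (ro M)" "involution_on (flg M) (rt M)"
  using wf by (auto simp: fmap_wf_def involution_on_def)

lemma finite_flg: "finite (flg M)"
  using wf by (simp add: fmap_wf_def)

lemma flg_closed [simp]:
  "x \<in> flg M \<Longrightarrow> rz M x \<in> flg M" "x \<in> flg M \<Longrightarrow> ro M x \<in> flg M" "x \<in> flg M \<Longrightarrow> rt M x \<in> flg M"
  "x \<in> flg M \<Longrightarrow> rz M (rz M x) = x" "x \<in> flg M \<Longrightarrow> ro M (ro M x) = x" "x \<in> flg M \<Longrightarrow> rt M (rt M x) = x"
  using wf by (auto simp: fmap_wf_def)

lemma flg_fixfree: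
  "x \<in> flg M \<Longrightarrow> rz M x \<noteq> x" "x \<in> flg M \<Longrightarrow> ro M x \<noteq> x" "x \<in> flg M \<Longrightarrow> rt M x \<noteq> x"
  "x \<in> flg M \<Longrightarrow> rz M (rt M x) = rt M (rz M x)" "x \<in> flg M \<Longrightarrow> rz M (rt M x) \<noteq> x"
  using wf by (auto simp: fmap_wf_def)

lemma orb_subset:
  "x \<in> flg M \<Longrightarrow> vorb M x \<subseteq> flg M" "x \<in> flg M \<Longrightarrow> eorb M x \<subseteq> flg M" "x \<in> flg M \<Longrightarrow> forb M x \<subseteq> flg M"
  unfolding vorb_eq eorb_eq forb_eq using orb2_subset[OF invol(2,3)] orb2_subset[OF invol(1,3)] orb2_subset[OF invol(1,2)]
  by blast+

lemma orb_self [simp]: "x \<in> vorb M x" "x \<in> eorb M x" "x \<in> forb M x"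
  unfolding vorb_eq eorb_eq forb_eq by simp_all

lemma orb_step [simp]:
  assumes "x \<in> flg M"
  shows "vorb M (ro M x) = vorb M x" "vorb M (rt M x) = vorb M x"
    "eorb M (rz M x) = eorb M x" "eorb M (rt M x) = eorb M x"
    "forb M (rz M x) = forb M x" "forb M (ro M x) = forb M x"
  unfolding vorb_eq eorb_eq forb_eq using assms
  by (simp_all add: orb2_left orb2_right invol)

lemma orb_eq_iff:
  assumes "x \<in> flg M"
  shows "vorb M y = vorb M x \<longleftrightarrow> y \<in> vorb M x" "eorb M y = eorb M x \<longleftrightarrow> y \<in> eorb M x"
    "forb M y = forb M x \<longleftrightarrow> y \<in> forb M x"
  unfolding vorb_eq eorb_eq forb_eq using assms by (simp_all add: orb2_eq_iff invol)

lemma orb_map_aut: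
  assumes "map_aut M a" "x \<in> flg M"
  shows "a ` vorb M x = vorb M (a x)" "a ` eorb M x = eorb M (a x)" "a ` forb M x = forb M (a x)"
proof -
  have a: "a ` flg M \<subseteq> flg M" using assms(1) by (auto simp: map_aut_def bij_betw_def)
  show "a ` vorb M x = vorb M (a x)" "a ` eorb M x = eorb M (a x)" "a ` forb M x = forb M (a x)"
    unfolding vorb_eq eorb_eq forb_eq
    by (rule orb2_image; use invol a assms in \<open>auto simp: map_aut_def\<close>)+
qed

lemma map_aut_inj: "map_aut M a \<Longrightarrow> inj_on a (flg M)"
  by (simp add: map_aut_def bij_betw_def)

lemma card_orb_map_aut:
  assumes "map_aut M a" "x \<in> flg M"
  shows "card (vorb M (a x)) = card (vorb M x)" "card (forb M (a x)) = card (forb M x)"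
proof -
  have "inj_on a (vorb M x)" "inj_on a (forb M x)"
    using map_aut_inj[OF assms(1)] orb_subset[OF assms(2)] by (auto intro: inj_on_subset)
  then show "card (vorb M (a x)) = card (vorb M x)" "card (forb M (a x)) = card (forb M x)"
    by (simp_all flip: orb_map_aut[OF assms] add: card_image)
qed

lemma card_face_map_aut:
  assumes "map_aut M a" "x \<in> flg M"
  shows "card (face_verts M (forb M (a x))) = card (face_verts M (forb M x))"
    "card (face_edges M (forb M (a x))) = card (face_edges M (forb M x))"
proof -
  have sub: "y \<in> flg M" if "y \<in> forb M x" for y using orb_subset(3)[OF assms(2)] that by blast
  have inj: "inj_on (image a) (Pow (flg M))"
    using map_aut_inj[OF assms(1)] by (rule inj_on_image_Pow)
  have "face_verts M (forb M (a x)) = image a ` face_verts M (forb M x)"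
    unfolding face_verts_def orb_map_aut(3)[OF assms, symmetric] image_image
    by (rule image_cong) (use sub in \<open>auto simp: orb_map_aut[OF assms(1)]\<close>)
  moreover have "face_verts M (forb M x) \<subseteq> Pow (flg M)"
    unfolding face_verts_def using sub orb_subset by blast
  ultimately show "card (face_verts M (forb M (a x))) = card (face_verts M (forb M x))"
    by (metis inj inj_on_subset card_image)
  have "face_edges M (forb M (a x)) = image a ` face_edges M (forb M x)"
    unfolding face_edges_def orb_map_aut(3)[OF assms, symmetric] image_image
    by (rule image_cong) (use sub in \<open>auto simp: orb_map_aut[OF assms(1)]\<close>)
  moreover have "face_edges M (forb M x) \<subseteq> Pow (flg M)"
    unfolding face_edges_def using sub orb_subset by blast
  ultimately show "card (face_edges M (forb M (a x))) = card (face_edges M (forb M x))"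
    by (metis inj inj_on_subset card_image)
qed

lemma card_orbits:
  "(\<And>x. x \<in> flg M \<Longrightarrow> card (vorb M x) = k) \<Longrightarrow> k * card (mverts M) = card (flg M)"
  "(\<And>x. x \<in> flg M \<Longrightarrow> card (eorb M x) = k) \<Longrightarrow> k * card (medges M) = card (flg M)"
  "(\<And>x. x \<in> flg M \<Longrightarrow> card (forb M x) = k) \<Longrightarrow> k * card (mfaces M) = card (flg M)"
  unfolding mverts_def medges_def mfaces_def vorb_eq eorb_eq forb_eq
  by (simp_all add: card_orb2_partition invol finite_flg)

text \<open>\<open>rz\<close> and \<open>rt\<close> commute, so they generate a Klein
  four-group.\<close>

lemma eorb_explicit:
  assumes x: "x \<in> flg M"
  shows "eorb M x = {x, rz M x, rt M x, rz M (rt M x)}"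
proof
  show "eorb M x \<subseteq> {x, rz M x, rt M x, rz M (rt M x)}"
  proof
    fix y assume "y \<in> eorb M x"
    then show "y \<in> {x, rz M x, rt M x, rz M (rt M x)}"
      unfolding eorb_eq
    proof (induction rule: orb2_induct)
      case (right z)
      have "rt M (rz M (rt M x)) = rz M x" using x flg_fixfree(4)[of "rt M x"] by simp
      then show ?case using right x flg_fixfree(4)[OF x] by auto
    qed (use x in auto)
  qed
  have "rz M (rt M x) \<in> eorb M x" using x by (simp flip: orb_eq_iff)
  then show "{x, rz M x, rt M x, rz M (rt M x)} \<subseteq> eorb M x"
    using orb2_step[of x "flg M" "rz M" "rt M" x] x by (simp add: eorb_eq)
qed

lemma card_eorb:
  assumes x: "x \<in> flg M"
  shows "card (eorb M x) = 4"
proof -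
  have "rz M x \<noteq> rt M x"
  proof
    assume "rz M x = rt M x"
    then have "rz M (rt M x) = x" using x by (metis flg_closed(4))
    then show False using flg_fixfree(5)[OF x] by simp
  qed
  moreover have "rz M x \<noteq> rz M (rt M x)" using x flg_fixfree(3) by (metis flg_closed(3,4))
  moreover have "rt M x \<noteq> rz M (rt M x)" using x flg_fixfree(1)[of "rt M x"] by (metis flg_closed(3))
  ultimately show ?thesis
    using flg_fixfree[OF x] by (simp add: eorb_explicit[OF x] card_insert_if eq_commute[of x])
qed

text \<open>Without loops the four flags of an edge meet the vertex only in a pair \<open>y\<close>,
  \<open>rt M y\<close>, so the edges at the vertex split its flags into pairs.\<close>

lemma card_vert_edges:
  assumes x: "x \<in> flg M" and noloop: "\<And>y. y \<in> flg M \<Longrightarrow> vorb M y \<noteq> vorb M (rz M y)"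
  shows "2 * card (vert_edges M (vorb M x)) = card (vorb M x)"
proof -
  let ?v = "vorb M x"
  have sub: "y \<in> flg M" if "y \<in> ?v" for y using orb_subset(1)[OF x] that by blast
  have pair: "eorb M y \<inter> ?v = {y, rt M y}" if y: "y \<in> ?v" for y
  proof -
    have yf: "y \<in> flg M" using sub y .
    have vy: "vorb M y = ?v" using orb_eq_iff(1)[OF x] y by simp
    have "rz M y \<notin> ?v" "rz M (rt M y) \<notin> ?v" "rt M y \<in> ?v"
      unfolding orb_eq_iff(1)[OF x, symmetric]
      using noloop[OF yf] noloop[of "rt M y"] yf vy by auto
    then show ?thesis using y by (auto simp: eorb_explicit[OF yf])
  qed
  have "(\<Union>e\<in>vert_edges M ?v. e \<inter> ?v) = ?v"
    unfolding vert_edges_def using orb_self(2) by fastforce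
  moreover have "card (\<Union>((\<lambda>e. e \<inter> ?v) ` vert_edges M ?v)) = 2 * card ((\<lambda>e. e \<inter> ?v) ` vert_edges M ?v)"
  proof (rule card_partition[symmetric])
    have "finite ?v" using finite_flg orb_subset(1)[OF x] finite_subset by blast
    then show "finite ((\<lambda>e. e \<inter> ?v) ` vert_edges M ?v)" "finite (\<Union>((\<lambda>e. e \<inter> ?v) ` vert_edges M ?v))"
      unfolding vert_edges_def by auto
    show "card A = 2" if A: "A \<in> (\<lambda>e. e \<inter> ?v) ` vert_edges M ?v" for A
    proof -
      obtain y where y: "y \<in> ?v" "A = eorb M y \<inter> ?v" using A by (auto simp: vert_edges_def)
      then have "A = {y, rt M y}" using pair by simp
      then show ?thesis using flg_fixfree(3)[OF sub[OF y(1)]] by simp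
    qed
    show "A \<inter> B = {}" if A: "A \<in> (\<lambda>e. e \<inter> ?v) ` vert_edges M ?v" "B \<in> (\<lambda>e. e \<inter> ?v) ` vert_edges M ?v" "A \<noteq> B" for A B
    proof -
      obtain y where y: "y \<in> ?v" "A = eorb M y \<inter> ?v" using A by (auto simp: vert_edges_def)
      obtain z where z: "z \<in> ?v" "B = eorb M z \<inter> ?v" using A by (auto simp: vert_edges_def)
      have "eorb M y \<inter> eorb M z = {}"
      proof (rule ccontr)
        assume "eorb M y \<inter> eorb M z \<noteq> {}"
        then obtain w where "w \<in> eorb M y" "w \<in> eorb M z" by auto
        then have "eorb M y = eorb M z"
          using orb_eq_iff(2)[OF sub[OF y(1)], of w] orb_eq_iff(2)[OF sub[OF z(1)], of w] by simp
        then show False using y z A(3) by simp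
      qed
      then show ?thesis using y z by auto
    qed
  qed
  moreover have "card ((\<lambda>e. e \<inter> ?v) ` vert_edges M ?v) = card (vert_edges M ?v)"
  proof (rule card_image, rule inj_onI)
    fix e1 e2 assume e: "e1 \<in> vert_edges M ?v" "e2 \<in> vert_edges M ?v" "e1 \<inter> ?v = e2 \<inter> ?v"
    then obtain y z where yz: "y \<in> ?v" "e1 = eorb M y" "z \<in> ?v" "e2 = eorb M z" by (auto simp: vert_edges_def)
    then have "y \<in> eorb M z" using e(3) by (metis IntE IntI orb_self(2))
    then show "e1 = e2" using yz sub orb_eq_iff(2) by blast
  qed
  ultimately show ?thesis by simp
qed

section \<open>Symmetry criteria in terms of flag orbits\<close>

lemma aut_eq_sym:
  assumes "x \<in> flg M" "aut_eq M x y"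
  shows "aut_eq M y x"
proof -
  obtain a where a: "map_aut M a" "a x = y" using assms(2) by (auto simp: aut_eq_def)
  define b where "b = inv_into (flg M) a"
  have bij: "bij_betw a (flg M) (flg M)" using a(1) by (simp add: map_aut_def)
  have bf: "b z \<in> flg M" if "z \<in> flg M" for z
    using bij that by (simp add: b_def bij_betw_def inv_into_into)
  have ab: "a (b z) = z" if "z \<in> flg M" for z
    using bij that by (simp add: b_def bij_betw_inv_into_right)
  have ba: "b (a z) = z" if "z \<in> flg M" for z
    using bij that by (simp add: b_def bij_betw_inv_into_left)
  have "map_aut M b"
    unfolding map_aut_def
  proof (intro conjI ballI)
    show "bij_betw b (flg M) (flg M)" unfolding b_def by (rule bij_betw_inv_into[OF bij])
    fix z assume z: "z \<in> flg M"
    have "a (rz M (b z)) = rz M z" "a (ro M (b z)) = ro M z" "a (rt M (b z)) = rt M z"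
      using a(1) bf[OF z] ab[OF z] by (simp_all add: map_aut_def)
    then show "b (rz M z) = rz M (b z)" "b (ro M z) = ro M (b z)" "b (rt M z) = rt M (b z)"
      using ba bf[OF z] flg_closed(1-3) by metis+
  qed
  then show ?thesis using ba[OF assms(1)] a(2) by (auto simp: aut_eq_def)
qed

text \<open>A one-step rotation at each flag generates the required cyclic group by
  \<open>cyclic_on_orbit_labels\<close>. The label-preserving involution is \<open>rt\<close> for
  the edges at a vertex, \<open>ro\<close> for the vertices of a face and \<open>rz\<close> for the
  edges of a face.\<close>

lemma rotaryI:
  assumes face: "\<And>x. x \<in> flg M \<Longrightarrow> aut_eq M x (rz M (ro M x))"
    and vert: "\<And>x. x \<in> flg M \<Longrightarrow> aut_eq M x (ro M (rt M x))"
  shows "rotary M"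
  unfolding rotary_def
proof (intro conjI ballI)
  fix v assume "v \<in> mverts M"
  then obtain x where x: "x \<in> flg M" "v = vorb M x" by (auto simp: mverts_def)
  obtain a where a: "map_aut M a" "a x = ro M (rt M x)" using vert[OF x(1)] by (auto simp: aut_eq_def)
  have "a ` v = v" using x a orb_map_aut(1)[OF a(1) x(1)] by simp
  moreover have "\<exists>k. (a ^^ k) ` e1 = e2" if "e1 \<in> vert_edges M v" "e2 \<in> vert_edges M v" for e1 e2
    by (rule cyclic_on_orbit_labels[where F = "flg M" and f = "ro M" and g = "rt M" and a = a and x = x and L = "eorb M"])
      (use a x that invol finite_flg in \<open>auto simp: map_aut_def orb_map_aut(2) vert_edges_def vorb_eq[symmetric]\<close>)
  ultimately show "\<exists>a. map_aut M a \<and> a ` v = v \<and>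
         (\<forall>e1\<in>vert_edges M v. \<forall>e2\<in>vert_edges M v. \<exists>k. (a ^^ k) ` e1 = e2)"
    using a(1) by blast
next
  fix Fa assume "Fa \<in> mfaces M"
  then obtain x where x: "x \<in> flg M" "Fa = forb M x" by (auto simp: mfaces_def)
  obtain a where a: "map_aut M a" "a x = rz M (ro M x)" using face[OF x(1)] by (auto simp: aut_eq_def)
  have "a ` Fa = Fa" using x a orb_map_aut(3)[OF a(1) x(1)] by simp
  moreover have "\<exists>k. (a ^^ k) ` e1 = e2" if "e1 \<in> face_verts M Fa" "e2 \<in> face_verts M Fa" for e1 e2
    by (rule cyclic_on_orbit_labels[where F = "flg M" and f = "rz M" and g = "ro M" and a = a and x = x and L = "vorb M"])
      (use a x that invol finite_flg in \<open>auto simp: map_aut_def orb_map_aut(1) face_verts_def forb_eq[symmetric]\<close>)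
  moreover have "\<exists>k. (a ^^ k) ` e1 = e2" if "e1 \<in> face_edges M Fa" "e2 \<in> face_edges M Fa" for e1 e2
    by (rule cyclic_on_orbit_labels[where F = "flg M" and f = "rz M" and g = "ro M" and a = a and x = x and L = "eorb M"])
      (use a x that invol finite_flg in \<open>auto simp: map_aut_def orb_map_aut(2) face_edges_def forb_eq[symmetric]\<close>)
  ultimately show "\<exists>a. map_aut M a \<and> a ` Fa = Fa \<and>
         (\<forall>v1\<in>face_verts M Fa. \<forall>v2\<in>face_verts M Fa. \<exists>k. (a ^^ k) ` v1 = v2) \<and>
         (\<forall>e1\<in>face_edges M Fa. \<forall>e2\<in>face_edges M Fa. \<exists>k. (a ^^ k) ` e1 = e2)"
    using a(1) by blast
qed

lemma reflexibleI:
  assumes "\<And>x y. x \<in> flg M \<Longrightarrow> y \<in> flg M \<Longrightarrow> aut_eq M x y"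
  shows "reflexible M"
  unfolding reflexible_def
proof (intro conjI ballI)
  show "rotary M" using assms by (intro rotaryI) auto
  fix Fa assume "Fa \<in> mfaces M"
  then obtain x where x: "x \<in> flg M" "Fa = forb M x" by (auto simp: mfaces_def)
  obtain a where a: "map_aut M a" "a x = ro M x" using assms[of x "ro M x"] x(1) by (auto simp: aut_eq_def)
  have "a ` Fa = Fa" using x a orb_map_aut(3)[OF a(1) x(1)] by simp
  then have "reflects_face M a Fa"
    \<comment> \<open>The exponent 0 leaves the reflection \<open>ro\<close> itself.\<close>
    unfolding reflects_face_def using x a by (intro conjI bexI[of _ x] exI[of _ 0]) auto
  then show "\<exists>a. map_aut M a \<and> reflects_face M a Fa" using a(1) by blast
qed

text \<open>Powers of \<open>rz\<close> after \<open>ro\<close> keep the colour and the extra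
  \<open>ro\<close> changes it, so a reflection of a face would relate two flags of different
  colours.\<close>

lemma not_reflexibleI:
  assumes col: "\<And>z. z \<in> flg M \<Longrightarrow> col (rz M z) \<noteq> col z \<and> col (ro M z) \<noteq> col z"
    and no: "\<And>x y. x \<in> flg M \<Longrightarrow> y \<in> flg M \<Longrightarrow> aut_eq M x y \<Longrightarrow> col x = (col y :: bool)"
  shows "\<not> reflexible M"
proof
  assume "reflexible M"
  obtain x0 where "x0 \<in> flg M" using wf by (auto simp: fmap_wf_def)
  then obtain a x k where ax: "map_aut M a" "x \<in> forb M x0" "a x = ((rz M \<circ> ro M) ^^ k) (ro M x)"
    using \<open>reflexible M\<close> by (auto simp: reflexible_def mfaces_def reflects_face_def)
  have x: "x \<in> flg M" using ax(2) orb_subset(3) \<open>x0 \<in> flg M\<close> by blast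
  have "((rz M \<circ> ro M) ^^ k) (ro M x) \<in> flg M \<and> col (((rz M \<circ> ro M) ^^ k) (ro M x)) \<noteq> col x"
  proof (induction k)
    case 0
    show ?case using x col by auto
  next
    case (Suc k)
    let ?z = "((rz M \<circ> ro M) ^^ k) (ro M x)"
    have z: "?z \<in> flg M" "ro M ?z \<in> flg M" "col ?z \<noteq> col x" using Suc flg_closed(2) by blast+
    have "col (rz M (ro M ?z)) \<noteq> col x" using col[OF z(1)] col[OF z(2)] z(3) by blast
    then show ?case using flg_closed(1)[OF z(2)] by (metis comp_apply funpow.simps(2))
  qed
  then show False using no[of x "a x"] ax x by (auto simp: aut_eq_def)
qed

section \<open>The boundary walk of one face\<close>

context
  fixes x p
  assumes x: "x \<in> flg M" and p: "p > 0" and per: "((\<lambda>z. ro M (rz M z)) ^^ p) x = x"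
    and injV: "inj_on (\<lambda>k. vorb M (((\<lambda>z. ro M (rz M z)) ^^ k) x)) {..<p}"
    and injE: "inj_on (\<lambda>k. eorb M (((\<lambda>z. ro M (rz M z)) ^^ k) x)) {..<p}"
begin

private abbreviation "phi k \<equiv> ((\<lambda>z. ro M (rz M z)) ^^ k) x"

lemma phi_flg: "phi k \<in> flg M"
  by (induction k) (auto simp: x)

lemma phi_mod: "phi k = phi (k mod p)"
proof -
  have "phi (p * j) = x" for j
    by (induction j) (simp_all add: funpow_add per)
  then have "phi (k mod p + p * (k div p)) = phi (k mod p)"
    by (simp only: funpow_add comp_apply)
  then show ?thesis by simp
qed

text \<open>A word in \<open>rz\<close> and \<open>ro\<close> is a step count along the boundary
  walk, possibly followed by \<open>rz\<close>.\<close>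

lemma forb_phi: "forb M x = phi ` {..<p} \<union> (\<lambda>k. rz M (phi k)) ` {..<p}"
proof
  have *: "phi k \<in> phi ` {..<p}" "rz M (phi k) \<in> (\<lambda>k. rz M (phi k)) ` {..<p}" for k
    by (subst phi_mod, use p in auto)+
  show "forb M x \<subseteq> phi ` {..<p} \<union> (\<lambda>k. rz M (phi k)) ` {..<p}"
  proof
    fix y assume "y \<in> forb M x"
    then show "y \<in> phi ` {..<p} \<union> (\<lambda>k. rz M (phi k)) ` {..<p}"
      unfolding forb_eq
    proof (induction rule: orb2_induct)
      case base
      show ?case using *(1)[of 0] by auto
    next
      case (left z)
      then show ?case using phi_flg by auto
    next
      case (right z)
      then consider k where "k < p" "z = phi k" | k where "z = rz M (phi k)" by auto
      then show ?case
      proof cases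
        case 1
        \<comment> \<open>Stepping back needs a positive index, so one period is added before 1 is
          subtracted.\<close>
        have "phi k = phi (k + p)" using phi_mod[of k] phi_mod[of "k + p"] by simp
        also have "\<dots> = ro M (rz M (phi (k + p - 1)))" using p by (cases p) simp_all
        finally have "ro M z = rz M (phi (k + p - 1))" using 1 phi_flg by simp
        then show ?thesis using *(2) by simp
      next
        case 2
        then have "ro M z = phi (Suc k)" by simp
        then show ?thesis using *(1) by (metis UnI1)
      qed
    qed
  qed
  have "forb M (phi k) = forb M x" for k
    by (induction k) (simp_all add: phi_flg)
  then have "phi k \<in> forb M x \<and> rz M (phi k) \<in> forb M x" for k
    by (simp flip: orb_eq_iff[OF x] add: phi_flg)
  then show "phi ` {..<p} \<union> (\<lambda>k. rz M (phi k)) ` {..<p} \<subseteq> forb M x" by auto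
qed

lemma vorb_phi_eq: "vorb M (phi j) = vorb M (phi k) \<Longrightarrow> phi j = phi k"
  using inj_onD[OF injV, of "j mod p" "k mod p"] phi_mod[of j] phi_mod[of k] p by auto

lemma vorb_rz_phi: "vorb M (rz M (phi k)) = vorb M (phi (Suc k))"
  using phi_flg[of k] by simp

lemma card_face_phi:
  "card (forb M x) = 2 * p" "card (face_verts M (forb M x)) = p" "card (face_edges M (forb M x)) = p"
proof -
  have inj: "inj_on phi {..<p}" using injV by (auto simp: inj_on_def)
  have inj2: "inj_on (\<lambda>k. rz M (phi k)) {..<p}"
  proof (rule inj_onI)
    fix j k assume jk: "j \<in> {..<p}" "k \<in> {..<p}" "rz M (phi j) = rz M (phi k)"
    then have "phi j = phi k" using phi_flg flg_closed(4) by metis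
    then show "j = k" using inj jk by (auto simp: inj_on_def)
  qed
  \<comment> \<open>A common flag \<open>phi j = rz M (phi k)\<close> lies at the vertex of
    \<open>phi (Suc k)\<close> and hence equals it; then \<open>ro\<close> would fix
    \<open>rz M (phi k)\<close>.\<close>
  have "phi ` {..<p} \<inter> (\<lambda>k. rz M (phi k)) ` {..<p} = {}"
  proof (rule ccontr)
    assume "phi ` {..<p} \<inter> (\<lambda>k. rz M (phi k)) ` {..<p} \<noteq> {}"
    then obtain j k where jk: "phi j = rz M (phi k)" by auto
    then have "phi j = phi (Suc k)" using vorb_rz_phi[of k] by (intro vorb_phi_eq) simp
    then show False using jk flg_fixfree(2)[of "rz M (phi k)"] phi_flg[of k] by simp
  qed
  then show "card (forb M x) = 2 * p"
    unfolding forb_phi by (simp add: card_Un_disjoint card_image inj inj2)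
  have *: "phi k \<in> phi ` {..<p}" for k by (subst phi_mod) (use p in auto)
  have "(\<lambda>k. vorb M (phi (Suc k))) ` {..<p} \<subseteq> vorb M ` phi ` {..<p}" using * by blast
  then have "face_verts M (forb M x) = vorb M ` phi ` {..<p}"
    unfolding face_verts_def forb_phi image_Un image_image vorb_rz_phi by (simp add: Un_absorb2)
  then show "card (face_verts M (forb M x)) = p"
    using card_image[OF injV] by (simp add: image_image)
  have "face_edges M (forb M x) = eorb M ` phi ` {..<p}"
    unfolding face_edges_def forb_phi image_Un image_image by (simp add: phi_flg)
  then show "card (face_edges M (forb M x)) = p"
    using card_image[OF injE] by (simp add: image_image)
qed

end

end

section \<open>The family of twisted maps\<close>

text \<open>A flag \<open>(i, a, b, s, e)\<close> of the unrolled map lies on the edge from \<open>(i, a)\<close> to \<open>(i + 1, b)\<close>, at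
  the end \<open>(i, a)\<close> if \<open>e\<close> is false and at \<open>(i + 1, b)\<close> otherwise; \<open>s\<close> is the sign in the
  recurrence of the face on its side of the edge.\<close>

type_synonym cflag = "int \<times> int \<times> int \<times> bool \<times> bool"

definition ev :: "bool \<Rightarrow> int" where
  "ev s = (if s then 1 else -1)"

lemma ev_simps [simp]: "ev True = 1" "ev False = -1" "ev (\<not> s) = - ev s" "ev s * ev s = 1"
  "ev (s = s') = ev s * ev s'"
  by (auto simp: ev_def)

fun r0 :: "cflag \<Rightarrow> cflag" where
  "r0 (i, a, b, s, e) = (i, a, b, s, \<not> e)"

text \<open>The recurrence is symmetric under reversing the face: next plus previous value is t
  times the middle one plus the sign. Hence one formula yields both the successor and the
  predecessor, and \<open>r1\<close> is an involution.\<close>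

fun r1 :: "int \<Rightarrow> cflag \<Rightarrow> cflag" where
  "r1 t (i, a, b, s, True) = (i + 1, b, t * b - a + ev s, s, False)"
| "r1 t (i, a, b, s, False) = (i - 1, t * a - b + ev s, a, s, True)"

fun r2 :: "cflag \<Rightarrow> cflag" where
  "r2 (i, a, b, s, e) = (i, a, b, \<not> s, e)"

fun vert :: "cflag \<Rightarrow> int \<times> int" where
  "vert (i, a, b, s, e) = (if e then (i + 1, b) else (i, a))"

lemma r_invol [simp]: "r0 (r0 x) = x" "r1 t (r1 t x) = x" "r2 (r2 x) = x" "r0 (r2 x) = r2 (r0 x)"
proof -
  obtain i a b s e where "x = (i, a, b, s, e)" by (cases x) auto
  then show "r0 (r0 x) = x" "r1 t (r1 t x) = x" "r2 (r2 x) = x" "r0 (r2 x) = r2 (r0 x)"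
    by (cases e; simp)+
qed

lemma vert_r [simp]: "vert (r1 t x) = vert x" "vert (r2 x) = vert x"
proof -
  obtain i a b s e where "x = (i, a, b, s, e)" by (cases x) auto
  then show "vert (r1 t x) = vert x" "vert (r2 x) = vert x" by (cases e; simp)+
qed

text \<open>Closing up is by $(i+n,j) \sim (i,\chi j + \tau)$, where $\chi = 1$ if \<open>c\<close> holds and $\chi = -1$
  otherwise; the last assumption provides the solutions of the homogeneous recurrence on the quotient.\<close>

locale twisted_map =
  fixes n m t \<tau> :: int and c :: bool
  assumes n3: "n \<ge> 3" and m3: "m \<ge> 3" and oddm: "odd m"
    and t\<tau>: "t * \<tau> = 2 * \<tau>" and c\<tau>: "c \<or> \<tau> = 0"
    and sol: "\<And>a b. \<exists>x :: int \<Rightarrow> int. x 0 = a \<and> x 1 = b \<and> (\<forall>i. x (i + 1) = t * x i - x (i - 1)) \<and>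
                (\<forall>i. m dvd x (i + n) - ev c * x i)"
begin

section \<open>Gluing along the n-cycle\<close>

definition par :: "int \<Rightarrow> bool" where
  "par k \<longleftrightarrow> c \<or> even k"

abbreviation sg :: "int \<Rightarrow> int" where
  "sg k \<equiv> ev (par k)"

lemma par_0 [simp]: "par 0"
  by (simp add: par_def)

lemma par_minus [simp]: "par (- k) = par k"
  by (simp add: par_def)

lemma par_add: "par (j + k) = (par j = par k)"
  by (auto simp: par_def)

lemma sg_\<tau> [simp]: "sg k * \<tau> = \<tau>"
  using c\<tau> by (auto simp: par_def)

lemma sg_\<tau>' [simp]: "sg k * (\<tau> * j) = \<tau> * j"
  by (simp flip: mult.assoc)

text \<open>This is the \<open>k\<close>-th iterate of j -> \<chi> j + \<tau>, also for negative
  \<open>k\<close>, with \<open>sg k\<close> = \<chi>^k. The closed form is available because \<tau>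
  = 0 whenever \<chi> = -1.\<close>

definition glue :: "int \<Rightarrow> int \<Rightarrow> int" where
  "glue k j = sg k * j + \<tau> * k"

lemma glue_add: "glue (j + k) a = glue j (glue k a)"
  using c\<tau> sg_\<tau>'[of j k] by (simp only: glue_def par_add ev_simps) (simp add: algebra_simps)

lemma glue_0 [simp]: "glue 0 a = a"
  by (simp add: glue_def)

lemma glue_dvd: "m dvd glue k a - glue k b \<longleftrightarrow> m dvd a - b"
proof -
  have "glue k a - glue k b = sg k * (a - b)" by (simp add: glue_def algebra_simps)
  then show ?thesis by (cases "par k") (auto simp: dvd_diff_commute)
qed

text \<open>Here \<open>k\<close> counts turns around the cycle. Negating the fibre coordinate
  negates the constant term of the recurrence, so \<open>s\<close> swaps whenever the turns
  contribute the factor -1.\<close>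

definition eqv :: "cflag \<Rightarrow> cflag \<Rightarrow> bool" where
  "eqv x y = (case x of (i, a, b, s, e) \<Rightarrow> case y of (i', a', b', s', e') \<Rightarrow>
     e = e' \<and> (\<exists>k. i' = i + n * k \<and> m dvd a - glue k a' \<and> m dvd b - glue k b' \<and> s = (s' = par k)))"

lemma eqv_iff: "eqv (i, a, b, s, e) (i', a', b', s', e') \<longleftrightarrow>
   e = e' \<and> (\<exists>k. i' = i + n * k \<and> m dvd a - glue k a' \<and> m dvd b - glue k b' \<and> s = (s' = par k))"
  by (simp add: eqv_def)

lemma eqvI:
  assumes "i' = i + n * k" "m dvd a - glue k a'" "m dvd b - glue k b'" "s = (s' = par k)"
  shows "eqv (i, a, b, s, e) (i', a', b', s', e)"
  using assms by (auto simp: eqv_iff)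

text \<open>The representative of a vertex in the fundamental domain: \<open>i div n\<close> turns
  are removed from the first coordinate and applied to the second.\<close>

definition lab :: "int \<Rightarrow> int \<Rightarrow> int \<times> int" where
  "lab i j = (i mod n, glue (i div n) j mod m)"

lemma lab_eq_iff: "lab i j = lab i' j' \<longleftrightarrow> (\<exists>k. i' = i + n * k \<and> m dvd j - glue k j')"
proof -
  have 1: "i mod n = i' mod n \<longleftrightarrow> (\<exists>k. i' = i + n * k)"
    by (metis mod_eq_dvd_iff dvd_def mod_mult_self2 add_diff_cancel_left' diff_add_cancel add.commute)
  have 2: "glue (i div n) j mod m = glue ((i + n * k) div n) j' mod m \<longleftrightarrow> m dvd j - glue k j'" for k
  proof -
    have "(i + n * k) div n = i div n + k" using n3 by simp
    then show ?thesis by (simp only: mod_eq_dvd_iff glue_add glue_dvd)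
  qed
  show ?thesis unfolding lab_def prod.inject 1 using 2 by metis
qed

text \<open>The two ends of an edge must be moved by the same number of turns, because
  \<open>n\<close> is nonzero.\<close>

lemma lab_fst_succ:
  assumes "lab i a = lab i' a'" "lab (i + 1) b = lab (i' + 1) b'"
  obtains k where "i' = i + n * k" "m dvd a - glue k a'" "m dvd b - glue k b'"
proof -
  obtain k l where "i' = i + n * k" "m dvd a - glue k a'" "i' + 1 = i + 1 + n * l" "m dvd b - glue l b'"
    using assms unfolding lab_eq_iff by blast
  moreover from this n3 have "l = k" by auto
  ultimately show ?thesis using that by blast
qed

text \<open>Equivalent flags get the same number, so that the quotient lives on a set of naturals.\<close>

definition code :: "cflag \<Rightarrow> nat" where
  "code x = (case x of (i, a, b, s, e) \<Rightarrow> to_nat (lab i a, lab (i + 1) b, s = par (i div n), e))"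

lemma code_eq_iff: "code x = code y \<longleftrightarrow> eqv x y"
proof -
  obtain i a b s e where x: "x = (i, a, b, s, e)" by (cases x) auto
  obtain i' a' b' s' e' where y: "y = (i', a', b', s', e')" by (cases y) auto
  have par: "par ((i + n * k) div n) = (par (i div n) = par k)" for k
    using n3 by (auto simp: par_add)
  have "code x = code y \<longleftrightarrow> lab i a = lab i' a' \<and> lab (i + 1) b = lab (i' + 1) b' \<and>
      (s = par (i div n)) = (s' = par (i' div n)) \<and> e = e'"
    by (simp add: x y code_def)
  also have "\<dots> \<longleftrightarrow> eqv x y"
  proof
    assume *: "lab i a = lab i' a' \<and> lab (i + 1) b = lab (i' + 1) b' \<and>
      (s = par (i div n)) = (s' = par (i' div n)) \<and> e = e'"
    then obtain k where k: "i' = i + n * k" "m dvd a - glue k a'" "m dvd b - glue k b'"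
      using lab_fst_succ[of i a i' a' b b'] by blast
    moreover have "s = (s' = par k)" using * unfolding k(1) par by blast
    ultimately show "eqv x y" using * eqvI[of i' i k a a' b b' s s' e] unfolding x y by blast
  next
    assume "eqv x y"
    then obtain k where k: "e = e'" "i' = i + n * k" "m dvd a - glue k a'" "m dvd b - glue k b'"
      "s = (s' = par k)" by (auto simp: x y eqv_iff)
    then show "lab i a = lab i' a' \<and> lab (i + 1) b = lab (i' + 1) b' \<and>
      (s = par (i div n)) = (s' = par (i' div n)) \<and> e = e'"
      unfolding lab_eq_iff k(2) par by (intro conjI exI[of _ k]) (auto simp: k)
  qed
  finally show ?thesis .
qed

lemma code_cong:
  assumes "m dvd a - a'" "m dvd b - b'"
  shows "code (i, a, b, s, e) = code (i, a', b', s, e)"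
  unfolding code_eq_iff by (rule eqvI[of _ _ 0]) (use assms in auto)

lemma code_shift: "code (i - n * k, glue k a, glue k b, s = par k, e) = code (i, a, b, s, e)"
  unfolding code_eq_iff by (rule eqvI[of _ _ k]) auto

section \<open>The quotient flag system\<close>

definition compat :: "(cflag \<Rightarrow> cflag) \<Rightarrow> bool" where
  "compat f \<longleftrightarrow> (\<forall>x y. eqv x y \<longrightarrow> eqv (f x) (f y))"

text \<open>\<open>inv code\<close> picks some representative; \<open>compat\<close> makes the
  result independent of the choice.\<close>

definition lift :: "(cflag \<Rightarrow> cflag) \<Rightarrow> nat \<Rightarrow> nat" where
  "lift f u = code (f (inv code u))"

lemma lift_code: "compat f \<Longrightarrow> lift f (code x) = code (f x)"
  unfolding lift_def compat_def code_eq_iff[symmetric] by (metis f_inv_into_f rangeI)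

lemma compat_r: "compat r0" "compat (r1 t)" "compat r2"
proof -
  have "eqv (r0 x) (r0 y) \<and> eqv (r1 t x) (r1 t y) \<and> eqv (r2 x) (r2 y)" if xy: "eqv x y" for x y
  proof -
    obtain i a b s e where x: "x = (i, a, b, s, e)" by (cases x) auto
    obtain i' a' b' s' e' where y: "y = (i', a', b', s', e')" by (cases y) auto
    obtain k where k: "e = e'" "i' = i + n * k" "m dvd a - glue k a'" "m dvd b - glue k b'"
      "s = (s' = par k)" using xy by (auto simp: x y eqv_iff)
    \<comment> \<open>The sign factor of \<open>glue\<close> matches the swap of \<open>s\<close>,
      and the translation by \<tau> k passes through the recurrence because t \<tau> - \<tau> =
      \<tau>.\<close>
    have next_dvd: "m dvd (t * v - u + ev s) - glue k (t * v' - u' + ev s')"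
      if "m dvd u - glue k u'" "m dvd v - glue k v'" for u v u' v'
    proof -
      have "(t * v - u + ev s) - glue k (t * v' - u' + ev s')
          = t * (v - glue k v') - (u - glue k u') + (t * \<tau> - 2 * \<tau>) * k"
        by (simp add: k(5) glue_def algebra_simps)
      also have "\<dots> = t * (v - glue k v') - (u - glue k u')" by (simp add: t\<tau>)
      also have "m dvd \<dots>" by (rule dvd_diff[OF dvd_mult[OF that(2)] that(1)])
      finally show ?thesis .
    qed
    have "eqv (r1 t x) (r1 t y)"
      using k next_dvd[of a a' b b'] next_dvd[of b b' a a'] by (cases e) (auto simp: x y intro!: eqvI[of _ _ k])
    moreover have "eqv (r0 x) (r0 y)" "eqv (r2 x) (r2 y)"
      using k by (auto simp: x y intro!: eqvI[of _ _ k])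
    ultimately show ?thesis by blast
  qed
  then show "compat r0" "compat (r1 t)" "compat r2" by (auto simp: compat_def)
qed

definition M :: "nat fmap" where
  "M = \<lparr>flg = range code, rz = lift r0, ro = lift (r1 t), rt = lift r2\<rparr>"

lemma M_code [simp]: "flg M = range code"
  "rz M (code x) = code (r0 x)" "ro M (code x) = code (r1 t x)" "rt M (code x) = code (r2 x)"
  by (simp_all add: M_def lift_code compat_r)

text \<open>Together with \<open>inj_code\<close> this gives a fundamental domain, hence finiteness
  and the count of 4 n m^2 flags.\<close>

lemma code_normal:
  "code x \<in> code ` ({0..<n} \<times> {0..<m} \<times> {0..<m} \<times> UNIV \<times> UNIV)"
proof -
  obtain i a b s e where x: "x = (i, a, b, s, e)" by (cases x) auto
  let ?k = "i div n"
  have "code (i - n * ?k, glue ?k a mod m, glue ?k b mod m, s = par ?k, e) = code x"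
    unfolding x code_shift[of i ?k a b s e, symmetric]
    by (rule code_cong) (simp_all add: dvd_diff_commute)
  moreover have "(i - n * ?k, glue ?k a mod m, glue ?k b mod m, s = par ?k, e)
      \<in> {0..<n} \<times> {0..<m} \<times> {0..<m} \<times> UNIV \<times> UNIV"
    using n3 m3 by (simp add: minus_mult_div_eq_mod)
  ultimately show ?thesis by (metis imageI)
qed

lemma inj_code: "inj_on code ({0..<n} \<times> {0..<m} \<times> {0..<m} \<times> UNIV \<times> UNIV)"
proof (rule inj_onI)
  fix x y
  assume xy: "x \<in> {0..<n} \<times> {0..<m} \<times> {0..<m} \<times> UNIV \<times> UNIV"
    "y \<in> {0..<n} \<times> {0..<m} \<times> {0..<m} \<times> UNIV \<times> UNIV" "code x = code y"
  obtain i a b s e where x: "x = (i, a, b, s, e)" by (cases x) auto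
  obtain i' a' b' s' e' where y: "y = (i', a', b', s', e')" by (cases y) auto
  obtain k where k: "e = e'" "i' = i + n * k" "m dvd a - glue k a'" "m dvd b - glue k b'"
    "s = (s' = par k)" using xy(3) by (auto simp: code_eq_iff x y eqv_iff)
  have "i' mod n = i mod n" using k(2) by simp
  then have i: "i' = i" using xy(1,2) by (simp add: x y)
  then have k0: "k = 0" using k(2) n3 by simp
  have "a mod m = a' mod m" "b mod m = b' mod m" using k(3,4) by (simp_all add: mod_eq_dvd_iff k0)
  then have "a = a'" "b = b'" using xy(1,2) by (simp_all add: x y)
  then show "x = y" using i k by (simp add: x y k0)
qed

lemma range_code: "range code = code ` ({0..<n} \<times> {0..<m} \<times> {0..<m} \<times> UNIV \<times> UNIV)"
  using code_normal by auto

lemma finite_flgM: "finite (range code)"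
  unfolding range_code by (intro finite_imageI finite_cartesian_product) auto

lemma card_flgM: "card (flg M) = 4 * nat n * nat m * nat m"
  unfolding M_code(1) range_code card_image[OF inj_code]
  by (simp add: card_cartesian_product UNIV_bool)

lemma code_r_neq: "code (r0 x) \<noteq> code x" "code (r1 t x) \<noteq> code x" "code (r2 x) \<noteq> code x" "code (r0 (r2 x)) \<noteq> code x"
proof -
  obtain i a b s e where x: "x = (i, a, b, s, e)" by (cases x) auto
  show "code (r0 x) \<noteq> code x" "code (r1 t x) \<noteq> code x" "code (r2 x) \<noteq> code x" "code (r0 (r2 x)) \<noteq> code x"
    unfolding code_eq_iff x by (cases e; use n3 in \<open>auto simp: eqv_iff\<close>)+
qed

lemma involM: "involution_on (flg M) (rz M)" "involution_on (flg M) (ro M)" "involution_on (flg M) (rt M)"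
  by (auto simp: involution_on_def)

section \<open>Vertices of the quotient and connectedness\<close>

lemma orb2_code_step:
  "code (r1 t x) \<in> vorb M (code x)" "code (r2 x) \<in> vorb M (code x)"
  using orb2_step[of "code x" "flg M" "ro M" "rt M" "code x"] by (simp_all add: vorb_eq)

lemma vorb_trans: "u \<in> vorb M v \<Longrightarrow> w \<in> vorb M u \<Longrightarrow> w \<in> vorb M v"
  unfolding vorb_eq by (rule orb2_trans)

lemma vorb_sym: "code x \<in> vorb M (code y) \<Longrightarrow> code y \<in> vorb M (code x)"
  unfolding vorb_eq by (rule orb2_sym[OF involM(2,3)]) auto

text \<open>The rotation at the lower end alternates between outgoing and incoming edges. Two of its
  steps return to an outgoing edge, and since 2 is a unit modulo \<open>m\<close>, all
  \<open>m\<close> outgoing edges are reached in this way.\<close>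

lemma rotate_r12: "r1 t (r2 (r1 t (r2 (i, a, b, s, False)))) = (i, a, b + 2 * ev s, s, False)"
  by (simp add: algebra_simps)

lemma rotation_induct:
  assumes base: "P (code (i, a, b, s, e))"
    and step: "\<And>b. P (code (i, a, b, s, e)) \<Longrightarrow> P (code (i, a, b + 2 * ev s, s, e))"
  shows "P (code (i, a, b', s, e))"
proof -
  have iter: "P (code (i, a, b + 2 * ev s * int k, s, e))" for k
  proof (induction k)
    case (Suc k)
    then show ?case using step[OF Suc] by (simp add: algebra_simps)
  qed (simp add: base)
  obtain h where h: "m = 2 * h + 1" using oddm by (rule oddE)
  \<comment> \<open>\<open>h + 1\<close> is the inverse of 2 modulo \<open>m\<close> and
    \<open>ev s\<close> is its own inverse, so \<open>k\<close> solves 2 \<open>ev s\<close> k = b'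
    - b modulo \<open>m\<close>.\<close>
  define k where "k = nat ((ev s * (b' - b) * (h + 1)) mod m)"
  have "int k = (ev s * (b' - b) * (h + 1)) mod m" using m3 by (simp add: k_def)
  then have "m dvd int k - ev s * (b' - b) * (h + 1)" by (metis mod_eq_dvd_iff mod_mod_trivial)
  then obtain w where w: "int k - ev s * (b' - b) * (h + 1) = m * w" by (auto simp: dvd_def)
  have "b + 2 * ev s * int k - b' = m * (2 * ev s * w + (b' - b))"
  proof -
    have kk: "int k = ev s * (b' - b) * (h + 1) + m * w" using w by simp
    have "2 * ev s * int k = (ev s * ev s) * (b' - b) * (2 * h + 2) + m * (2 * ev s * w)"
      unfolding kk by (simp only: ring_distribs mult_ac)
    also have "\<dots> = (b' - b) * (m + 1) + m * (2 * ev s * w)" by (simp add: h algebra_simps)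
    finally show ?thesis by (simp add: algebra_simps)
  qed
  then have "m dvd b + 2 * ev s * int k - b'" by simp
  then have "code (i, a, b + 2 * ev s * int k, s, e) = code (i, a, b', s, e)"
    by (intro code_cong) auto
  then show ?thesis using iter by metis
qed

lemma vorb_same_vert_False: "code (i, a, b', s', False) \<in> vorb M (code (i, a, b, s, False))"
proof -
  have step: "code (r1 t (r2 (r1 t (r2 x)))) \<in> vorb M (code x)" for x
    using orb2_code_step vorb_trans by meson
  have 1: "code (i, a, b', s, False) \<in> vorb M (code (i, a, b, s, False))"
  proof (rule rotation_induct[where b = b and P = "\<lambda>u. u \<in> vorb M (code (i, a, b, s, False))"])
    show "code (i, a, b, s, False) \<in> vorb M (code (i, a, b, s, False))" by (simp add: vorb_eq)
    show "code (i, a, b'' + 2 * ev s, s, False) \<in> vorb M (code (i, a, b, s, False))"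
      if "code (i, a, b'', s, False) \<in> vorb M (code (i, a, b, s, False))" for b''
      using vorb_trans[OF that step] unfolding rotate_r12 .
  qed
  show ?thesis
  proof (cases "s' = s")
    case False
    then have "r2 (i, a, b', s, False) = (i, a, b', s', False)" by auto
    then show ?thesis using 1 orb2_code_step(2) vorb_trans by metis
  qed (use 1 in simp)
qed

lemma vorb_same_vert:
  assumes "vert x = vert y"
  shows "code y \<in> vorb M (code x)"
proof -
  have *: "\<exists>b s. code (fst (vert x), snd (vert x), b, s, False) \<in> vorb M (code x)" for x
  proof -
    obtain i a b s e where x: "x = (i, a, b, s, e)" by (cases x) auto
    show ?thesis
    proof (cases e)
      case True
      then show ?thesis using orb2_code_step(1)[of x] by (auto simp: x)
    next
      case False
      moreover have "code x \<in> vorb M (code x)" by (simp add: vorb_eq)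
      ultimately show ?thesis by (auto simp: x)
    qed
  qed
  obtain b s where 1: "code (fst (vert x), snd (vert x), b, s, False) \<in> vorb M (code x)" using * by blast
  obtain b' s' where 2: "code (fst (vert y), snd (vert y), b', s', False) \<in> vorb M (code y)" using * by blast
  have "code (fst (vert x), snd (vert x), b', s', False) \<in> vorb M (code x)"
    using vorb_trans[OF 1 vorb_same_vert_False] .
  then show ?thesis using vorb_trans vorb_sym[OF 2] assms by metis
qed

abbreviation vlab :: "cflag \<Rightarrow> int \<times> int" where
  "vlab x \<equiv> lab (fst (vert x)) (snd (vert x))"

lemma vlab_eqv: "eqv x y \<Longrightarrow> vlab x = vlab y"
proof -
  assume xy: "eqv x y"
  obtain i a b s e where x: "x = (i, a, b, s, e)" by (cases x) auto
  obtain i' a' b' s' e' where y: "y = (i', a', b', s', e')" by (cases y) auto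
  obtain k where k: "e = e'" "i' = i + n * k" "m dvd a - glue k a'" "m dvd b - glue k b'"
    using xy by (auto simp: x y eqv_iff)
  then show "vlab x = vlab y" unfolding lab_eq_iff by (auto simp: x y intro!: exI[of _ k])
qed

lemma vorb_iff: "code y \<in> vorb M (code x) \<longleftrightarrow> vlab x = vlab y"
proof
  assume "code y \<in> vorb M (code x)"
  \<comment> \<open>The induction runs over codes, so the claim speaks of all representatives of the
    current code.\<close>
  then have "\<forall>z. code z = code y \<longrightarrow> vlab z = vlab x" unfolding vorb_eq
  proof (induction rule: orb2_induct)
    case base
    then show ?case using vlab_eqv by (auto simp: code_eq_iff)
  next
    case (left u)
    then obtain w where w: "u = code w" "vlab w = vlab x" by auto
    show ?case
    proof (intro allI impI)
      fix z assume "code z = ro M u"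
      then have "vlab z = vlab (r1 t w)" using vlab_eqv by (simp add: w code_eq_iff)
      then show "vlab z = vlab x" using w by simp
    qed
  next
    case (right u)
    then obtain w where w: "u = code w" "vlab w = vlab x" by auto
    show ?case
    proof (intro allI impI)
      fix z assume "code z = rt M u"
      then have "vlab z = vlab (r2 w)" using vlab_eqv by (simp add: w code_eq_iff)
      then show "vlab z = vlab x" using w by simp
    qed
  qed
  then show "vlab x = vlab y" by metis
next
  assume eq: "vlab x = vlab y"
  obtain i a b s e where y: "y = (i, a, b, s, e)" by (cases y) auto
  obtain k where k: "fst (vert y) = fst (vert x) + n * k" "m dvd snd (vert x) - glue k (snd (vert y))"
    using eq unfolding lab_eq_iff by blast
  \<comment> \<open>\<open>y'\<close> is \<open>y\<close> moved back by \<open>k\<close> turns, with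
    the coordinate at its own vertex replaced by the congruent one of \<open>x\<close>, so that the
    two vertices agree literally and not just modulo \<open>m\<close>.\<close>
  define y' where "y' = (i - n * k, if e then glue k a else snd (vert x), if e then snd (vert x) else glue k b, s = par k, e)"
  have "vert y' = vert x" using k(1) by (cases e) (auto simp: y y'_def prod_eq_iff)
  moreover have "code y' = code y" unfolding y'_def y
    by (subst code_shift[of i k a b s e, symmetric], rule code_cong) (use k(2) in \<open>auto simp: y\<close>)
  ultimately show "code y \<in> vorb M (code x)" using vorb_same_vert[of x y'] by simp
qed

text \<open>Rotation at the lower end of an edge changes \<open>b\<close> at will, rotation at the
  upper end changes \<open>a\<close>. So each flag is joined to a base flag at its level
  \<open>i\<close>, and base flags at consecutive levels are joined through their common
  vertex.\<close>

lemma connected: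
  "(code x, code y) \<in> ({(z, rz M z) | z. z \<in> flg M} \<union> {(z, ro M z) | z. z \<in> flg M}
                   \<union> {(z, rt M z) | z. z \<in> flg M})\<^sup>*" (is "_ \<in> ?R\<^sup>*")
proof -
  have "sym ?R"
  proof (rule symI)
    fix u v assume "(u, v) \<in> ?R"
    then obtain z where "u = code z" "v = code (r0 z) \<or> v = code (r1 t z) \<or> v = code (r2 z)" by auto
    then have "v \<in> flg M \<and> (u = rz M v \<or> u = ro M v \<or> u = rt M v)" by auto
    then show "(v, u) \<in> ?R" by blast
  qed
  then have symR: "(v, u) \<in> ?R\<^sup>*" if "(u, v) \<in> ?R\<^sup>*" for u v
    using sym_rtrancl that by (meson symD)
  have zstep: "(code x, code (r0 x)) \<in> ?R\<^sup>*" for x by (rule r_into_rtrancl) auto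
  have tstep: "(code x, code (r2 x)) \<in> ?R\<^sup>*" for x by (rule r_into_rtrancl) auto
  have v: "(code x, code y) \<in> ?R\<^sup>*" if "vert x = vert y" for x y
  proof -
    have "(code x, code y) \<in> ({(z, ro M z) | z. z \<in> flg M} \<union> {(z, rt M z) | z. z \<in> flg M})\<^sup>*"
      using vorb_same_vert[OF that] by (simp add: vorb_def)
    then show ?thesis by (rule rtrancl_mono[THEN subsetD, rotated]) auto
  qed
  have base: "(code (i, a, b, s, e), code (i, 0, 0, True, False)) \<in> ?R\<^sup>*" for i a b s e
  proof -
    have "(code (i, a, b, s, e), code (i, a, b, s, False)) \<in> ?R\<^sup>*"
      using zstep[of "(i, a, b, s, e)"] by (cases e) auto
    also have "(code (i, a, b, s, False), code (i, a, 0, True, False)) \<in> ?R\<^sup>*" by (rule v) simp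
    also have "(code (i, a, 0, True, False), code (i, a, 0, True, True)) \<in> ?R\<^sup>*"
      using zstep[of "(i, a, 0, True, False)"] by simp
    also have "(code (i, a, 0, True, True), code (i, 0, 0, True, True)) \<in> ?R\<^sup>*" by (rule v) simp
    also have "(code (i, 0, 0, True, True), code (i, 0, 0, True, False)) \<in> ?R\<^sup>*"
      using zstep[of "(i, 0, 0, True, True)"] by simp
    finally show ?thesis .
  qed
  have succ: "(code (i, 0, 0, True, False), code (i + 1, 0, 0, True, False)) \<in> ?R\<^sup>*" for i
  proof -
    have "(code (i, 0, 0, True, False), code (i, 0, 0, True, True)) \<in> ?R\<^sup>*"
      using symR[OF base] .
    also have "(code (i, 0, 0, True, True), code (i + 1, 0, 0, True, False)) \<in> ?R\<^sup>*" by (rule v) simp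
    finally show ?thesis .
  qed
  have all: "(code (0, 0, 0, True, False), code (i, 0, 0, True, False)) \<in> ?R\<^sup>*" for i
  proof (induction i rule: int_induct[where k = 0])
    case (step1 i)
    then show ?case using succ[of i] by (meson rtrancl_trans)
  next
    case (step2 i)
    have "(code (i, 0, 0, True, False), code (i - 1, 0, 0, True, False)) \<in> ?R\<^sup>*"
      using symR[OF succ[of "i - 1"]] by (simp only: diff_add_cancel)
    with step2(2) show ?case by (rule rtrancl_trans)
  qed (rule rtrancl_refl)
  obtain i a b s e where x: "x = (i, a, b, s, e)" by (cases x) auto
  obtain i' a' b' s' e' where y: "y = (i', a', b', s', e')" by (cases y) auto
  show ?thesis
    using rtrancl_trans[OF base[of i a b s e] symR[OF all[of i]]] rtrancl_trans[OF all[of i'] symR[OF base[of i' a' b' s' e']]]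
    unfolding x y by (rule rtrancl_trans)
qed

lemma wfM: "fmap_wf M"
  unfolding fmap_wf_def
proof (intro conjI ballI)
  fix u v assume "u \<in> flg M" "v \<in> flg M"
  then show "(u, v) \<in> ({(z, rz M z) | z. z \<in> flg M} \<union> {(z, ro M z) | z. z \<in> flg M}
                   \<union> {(z, rt M z) | z. z \<in> flg M})\<^sup>*"
    using connected by auto
qed (use finite_flgM code_r_neq in auto)

sublocale flag_map M
  by unfold_locales (rule wfM)

end

section \<open>Skeleton and automorphisms\<close>

text \<open>The two orientation classes; they descend to the quotient only if $\chi = 1$.\<close>

fun cls :: "cflag \<Rightarrow> bool" where
  "cls (i, a, b, s, e) = (s \<noteq> e)"

lemma cls_r [simp]: "cls (r0 x) = (\<not> cls x)" "cls (r1 t x) = (\<not> cls x)" "cls (r2 x) = (\<not> cls x)"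
proof -
  obtain i a b s e where "x = (i, a, b, s, e)" by (cases x) auto
  then show "cls (r0 x) = (\<not> cls x)" "cls (r1 t x) = (\<not> cls x)" "cls (r2 x) = (\<not> cls x)"
    by (cases e; auto)+
qed

context twisted_map
begin

lemma vorb_eq_iff: "vorb M (code x) = vorb M (code y) \<longleftrightarrow> vlab x = vlab y"
  using orb_eq_iff(1)[of "code x" "code y"] vorb_iff by auto

lemma lab_succ_neq: "lab i a \<noteq> lab (i + 1) b"
proof
  assume "lab i a = lab (i + 1) b"
  then obtain k where "i + 1 = i + n * k" unfolding lab_eq_iff by blast
  then have "n dvd 1" by (metis add_left_cancel dvd_triv_left)
  then show False using n3 by (simp add: zdvd_not_zless)
qed

text \<open>Traversing one edge upwards and the other one upwards too would close up after two
  levels, so \<open>n\<close> would divide 2. This rules out two edges with the same ends in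
  opposite order.\<close>

lemma lab_cross:
  assumes "lab i a = lab (i' + 1) b'" "lab (i + 1) b = lab i' a'"
  shows False
proof -
  obtain k l where "i' + 1 = i + n * k" "i' = i + 1 + n * l"
    using assms unfolding lab_eq_iff by blast
  then have "2 = n * (k - l)" by (simp add: right_diff_distrib)
  then have "n dvd 2" by (metis dvd_triv_left)
  then show False using n3 by (simp add: zdvd_not_zless)
qed

lemma no_loop: "x \<in> flg M \<Longrightarrow> vorb M x \<noteq> vorb M (rz M x)"
proof -
  assume "x \<in> flg M"
  then obtain i a b s e where x: "x = code (i, a, b, s, e)" by auto
  show ?thesis
    using lab_succ_neq[of i a b] lab_succ_neq[of i a b, symmetric] by (simp add: x vorb_eq_iff)
qed

lemma eorb_same: "eorb M (code (i, a, b, s', e')) = eorb M (code (i, a, b, s, e))"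
proof -
  have e: "eorb M (code (i, a, b, s, True)) = eorb M (code (i, a, b, s, False))" for s
    using orb_step(3)[of "code (i, a, b, s, False)"] by simp
  have s: "eorb M (code (i, a, b, True, e)) = eorb M (code (i, a, b, False, e))" for e
    using orb_step(4)[of "code (i, a, b, False, e)"] by simp
  show ?thesis by (cases s; cases s'; cases e; cases e'; simp add: e s)
qed

lemma eorb_code_iff:
  "eorb M (code (i, a, b, s, e)) = eorb M (code (i', a', b', s', e')) \<longleftrightarrow>
   lab i a = lab i' a' \<and> lab (i + 1) b = lab (i' + 1) b'"
proof
  assume "eorb M (code (i, a, b, s, e)) = eorb M (code (i', a', b', s', e'))"
  then have "code (i', a', b', s', e') \<in> eorb M (code (i, a, b, s, e))" by simp
  then have "\<exists>s e. code (i, a, b, s, e) = code (i', a', b', s', e')"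
    by (simp add: eorb_explicit) metis
  then show "lab i a = lab i' a' \<and> lab (i + 1) b = lab (i' + 1) b'"
    unfolding code_eq_iff eqv_iff lab_eq_iff by auto
next
  assume "lab i a = lab i' a' \<and> lab (i + 1) b = lab (i' + 1) b'"
  then obtain k where "i' = i + n * k" "m dvd a - glue k a'" "m dvd b - glue k b'"
    using lab_fst_succ[of i a i' a' b b'] by blast
  then have "code (i, a, b, s' = par k, e') = code (i', a', b', s', e')"
    unfolding code_eq_iff by (rule eqvI) simp
  then show "eorb M (code (i, a, b, s, e)) = eorb M (code (i', a', b', s', e'))"
    using eorb_same by metis
qed

lemma simple_skeletonM: "simple_skeleton M"
  unfolding simple_skeleton_def
proof (intro conjI ballI impI)
  fix x y assume "x \<in> flg M" "y \<in> flg M"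
    and eq: "{vorb M x, vorb M (rz M x)} = {vorb M y, vorb M (rz M y)}"
  then obtain i a b s e i' a' b' s' e' where x: "x = code (i, a, b, s, e)" and y: "y = code (i', a', b', s', e')"
    by auto
  have "{vorb M (code (i, a, b, s, False)), vorb M (code (i, a, b, s, True))} =
      {vorb M (code (i', a', b', s', False)), vorb M (code (i', a', b', s', True))}"
    using eq unfolding x y by (cases e; cases e') (simp_all add: insert_commute)
  then have "lab i a = lab i' a' \<and> lab (i + 1) b = lab (i' + 1) b' \<or>
      lab i a = lab (i' + 1) b' \<and> lab (i + 1) b = lab i' a'"
    by (simp add: doubleton_eq_iff vorb_eq_iff)
  then show "eorb M x = eorb M y"
    unfolding x y eorb_code_iff using lab_cross by blast
qed (rule no_loop)

section \<open>Identification of the skeleton with C_n[mK_1]\<close>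

definition nat_lab :: "int \<times> int \<Rightarrow> nat \<times> nat" where
  "nat_lab l = (nat (fst l), nat (snd l))"

lemma nat_lab_eq_iff: "nat_lab (lab i j) = nat_lab (lab i' j') \<longleftrightarrow> lab i j = lab i' j'"
  using n3 m3 by (auto simp: nat_lab_def lab_def eq_nat_nat_iff)

lemma succ_mod_iff:
  "(fst (nat_lab (lab i a)) + 1) mod nat n = fst (nat_lab (lab i' b')) \<longleftrightarrow> (\<exists>k. i' = i + 1 + n * k)"
proof -
  have "(fst (nat_lab (lab i a)) + 1) mod nat n = nat ((i + 1) mod n)"
  proof -
    have "(nat (i mod n) + 1) mod nat n = nat ((i mod n + 1) mod n)"
      using n3 by (simp add: nat_mod_distrib nat_add_distrib)
    then show ?thesis by (simp add: nat_lab_def lab_def mod_add_left_eq)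
  qed
  moreover have "fst (nat_lab (lab i' b')) = nat (i' mod n)" by (simp add: nat_lab_def lab_def)
  moreover have "nat ((i + 1) mod n) = nat (i' mod n) \<longleftrightarrow> (i + 1) mod n = i' mod n"
    using n3 by (simp add: eq_nat_nat_iff)
  moreover have "(i + 1) mod n = i' mod n \<longleftrightarrow> (\<exists>k. i' = i + 1 + n * k)"
    by (metis mod_eq_dvd_iff dvd_def mod_mult_self2 add_diff_cancel_left' diff_add_cancel add.commute)
  ultimately show ?thesis by simp
qed

definition vname :: "nat set \<Rightarrow> nat \<times> nat" where
  "vname u = nat_lab (vlab (SOME x. vorb M (code x) = u))"

lemma vname_vorb: "vname (vorb M (code x)) = nat_lab (vlab x)"
proof -
  have "vorb M (code (SOME y. vorb M (code y) = vorb M (code x))) = vorb M (code x)"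
    by (rule someI[of _ x]) simp
  then show ?thesis by (simp add: vname_def vorb_eq_iff)
qed

lemma bij_vname: "bij_betw vname (mverts M) ({0..<nat n} \<times> {0..<nat m})"
  unfolding bij_betw_def
proof
  show "inj_on vname (mverts M)"
    by (auto simp: inj_on_def mverts_def vname_vorb nat_lab_eq_iff vorb_eq_iff simp del: vert.simps split_paired_All)
  have "vname v \<in> {0..<nat n} \<times> {0..<nat m}" if "v \<in> mverts M" for v
    using that n3 m3 by (auto simp: mverts_def vname_vorb nat_lab_def lab_def simp del: vert.simps)
  moreover have "(i, j) \<in> vname ` mverts M" if "i < nat n" "j < nat m" for i j
  proof
    show "vorb M (code (int i, int j, 0, True, False)) \<in> mverts M" by (auto simp: mverts_def)
    show "(i, j) = vname (vorb M (code (int i, int j, 0, True, False)))"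
      using that by (simp add: vname_vorb nat_lab_def lab_def)
  qed
  ultimately show "vname ` mverts M = {0..<nat n} \<times> {0..<nat m}"
    by (intro equalityI image_subsetI) auto
qed

lemma adj_iff:
  "skel_adj M (vorb M (code x)) (vorb M (code y)) \<longleftrightarrow>
     (\<exists>k. fst (vert y) = fst (vert x) + 1 + n * k) \<or> (\<exists>k. fst (vert x) = fst (vert y) + 1 + n * k)"
proof
  assume "skel_adj M (vorb M (code x)) (vorb M (code y))"
  then obtain z where z: "vlab z = vlab x" "vlab (r0 z) = vlab y"
    by (auto simp: skel_adj_def vorb_eq_iff simp del: vert.simps r0.simps)
  obtain i a b s e where zz: "z = (i, a, b, s, e)" by (cases z) auto
  obtain k l where "fst (vert x) = fst (vert z) + n * k" "fst (vert y) = fst (vert (r0 z)) + n * l"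
    using z unfolding lab_eq_iff by blast
  then have "if e then fst (vert x) = fst (vert y) + 1 + n * (k - l)
      else fst (vert y) = fst (vert x) + 1 + n * (l - k)"
    unfolding zz by (auto simp: algebra_simps)
  then show "(\<exists>k. fst (vert y) = fst (vert x) + 1 + n * k) \<or> (\<exists>k. fst (vert x) = fst (vert y) + 1 + n * k)"
    by (metis (full_types))
next
  have *: "skel_adj M (vorb M (code x)) (vorb M (code y))"
    if xy: "fst (vert y) = fst (vert x) + 1 + n * k" for x y k
  proof -
    \<comment> \<open>The flag of the edge from \<open>x\<close> to the vertex of \<open>y\<close>,
      the latter pulled back by \<open>k\<close> turns to the level just above
      \<open>x\<close>.\<close>
    let ?z = "(fst (vert x), snd (vert x), glue k (snd (vert y)), True, False)"
    have "vorb M (code ?z) = vorb M (code x)" by (simp add: vorb_eq_iff)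
    moreover have "vorb M (rz M (code ?z)) = vorb M (code y)"
      by (simp add: vorb_eq_iff lab_eq_iff xy) (use dvd_refl in \<open>auto intro: exI[of _ k]\<close>)
    ultimately show ?thesis unfolding skel_adj_def by (metis M_code(1) rangeI)
  qed
  have sym: "skel_adj M v u" if "skel_adj M u v" for u v
    using that unfolding skel_adj_def by (metis flg_closed(1,4))
  assume "(\<exists>k. fst (vert y) = fst (vert x) + 1 + n * k) \<or> (\<exists>k. fst (vert x) = fst (vert y) + 1 + n * k)"
  then show "skel_adj M (vorb M (code x)) (vorb M (code y))" using * sym by blast
qed

lemma skeletonM: "skeleton_is M ({0..<nat n} \<times> {0..<nat m}) (lexcyc_adj (nat n) (nat m))"
  unfolding skeleton_is_def
proof (intro conjI simple_skeletonM exI[of _ vname] bij_vname ballI)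
  fix u w assume uw: "u \<in> mverts M" "w \<in> mverts M"
  then obtain x y where xy: "u = vorb M (code x)" "w = vorb M (code y)" by (auto simp: mverts_def)
  have "vname u \<in> {0..<nat n} \<times> {0..<nat m}" "vname w \<in> {0..<nat n} \<times> {0..<nat m}"
    using bij_vname uw by (auto simp: bij_betw_def)
  then have "lexcyc_adj (nat n) (nat m) (vname u) (vname w) \<longleftrightarrow>
      (fst (vname u) + 1) mod nat n = fst (vname w) \<or> (fst (vname w) + 1) mod nat n = fst (vname u)"
    by (auto simp: lexcyc_adj_def)
  then show "skel_adj M u w \<longleftrightarrow> lexcyc_adj (nat n) (nat m) (vname u) (vname w)"
    unfolding xy vname_vorb succ_mod_iff adj_iff by simp
qed

section \<open>Automorphisms induced from the unrolled map\<close>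

definition cover_aut :: "(cflag \<Rightarrow> cflag) \<Rightarrow> bool" where
  "cover_aut A \<longleftrightarrow> compat A \<and> surj A \<and>
     (\<forall>x. A (r0 x) = r0 (A x) \<and> A (r1 t x) = r1 t (A x) \<and> A (r2 x) = r2 (A x))"

text \<open>On the finite quotient a surjection is bijective, so no inverse has to be shown
  compatible with the gluing.\<close>

lemma cover_aut_aut_eq:
  assumes "cover_aut A"
  shows "aut_eq M (code x) (code (A x))"
proof -
  have A: "compat A" "surj A" and comm: "A (r0 x) = r0 (A x)" "A (r1 t x) = r1 t (A x)" "A (r2 x) = r2 (A x)" for x
    using assms unfolding cover_aut_def by blast+
  have img: "lift A ` flg M = flg M"
    using A(2) by (simp add: image_image lift_code[OF A(1)]) (metis image_image)
  moreover have "inj_on (lift A) (flg M)"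
    using img by (intro finite_surj_inj) (simp_all add: finite_flgM)
  ultimately have "bij_betw (lift A) (flg M) (flg M)" by (simp add: bij_betw_def)
  then have "map_aut M (lift A)"
    by (auto simp: map_aut_def lift_code[OF A(1)] comm simp del: r0.simps r2.simps r1.simps split_paired_All)
  then show ?thesis unfolding aut_eq_def using lift_code[OF A(1)] by blast
qed

lemma aut_eq_translate: "aut_eq M (code (i, a, b, s, e)) (code (i + j, a, b, s, e))"
proof -
  define A :: "cflag \<Rightarrow> cflag" where "A = (\<lambda>(i, a, b, s, e). (i + j, a, b, s, e))"
  have "cover_aut A"
    unfolding cover_aut_def
  proof (intro conjI allI)
    show "compat A" unfolding compat_def A_def by (auto simp: eqv_iff algebra_simps)
    show "surj A" by (rule surjI[of _ "\<lambda>(i, a, b, s, e). (i - j, a, b, s, e)"]) (auto simp: A_def)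
    fix x :: cflag obtain i a b s e where x: "x = (i, a, b, s, e)" by (cases x) auto
    show "A (r0 x) = r0 (A x)" "A (r1 t x) = r1 t (A x)" "A (r2 x) = r2 (A x)"
      by (cases e; simp add: x A_def)+
  qed
  from cover_aut_aut_eq[OF this] show ?thesis by (auto simp: A_def dest: spec[of _ "(i, a, b, s, e)"])
qed

lemma glue_minus: "glue (- k) (- a) = - glue k a"
  by (simp add: glue_def)

text \<open>The half-turn exchanges lower and upper ends and negates the fibres, so \<open>e\<close>
  and \<open>s\<close> flip together and the orientation class is kept. A turn counted
  \<open>k\<close> becomes one counted \<open>- k\<close>.\<close>

lemma aut_eq_rotate: "aut_eq M (code (i, a, b, s, e)) (code (- i - 1, - b, - a, \<not> s, \<not> e))"
proof -
  define A :: "cflag \<Rightarrow> cflag" where "A = (\<lambda>(i, a, b, s, e). (- i - 1, - b, - a, \<not> s, \<not> e))"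
  have AA: "A (A x) = x" for x by (cases x) (simp add: A_def)
  have "cover_aut A"
    unfolding cover_aut_def
  proof (intro conjI allI)
    have neg: "m dvd - a - glue (- k) (- a')" if "m dvd a - glue k a'" for a a' k
    proof -
      have "- a - glue (- k) (- a') = - (a - glue k a')" by (simp only: glue_minus)
      then show ?thesis using that by (simp only: dvd_minus_iff)
    qed
    show "compat A" unfolding compat_def
    proof (intro allI impI)
      fix x y assume xy: "eqv x y"
      obtain i a b s e where x: "x = (i, a, b, s, e)" by (cases x) auto
      obtain i' a' b' s' e' where y: "y = (i', a', b', s', e')" by (cases y) auto
      obtain k where k: "e = e'" "i' = i + n * k" "m dvd a - glue k a'" "m dvd b - glue k b'"
        "s = (s' = par k)" using xy by (auto simp: x y eqv_iff)
      show "eqv (A x) (A y)"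
        unfolding x y A_def by (simp add: k(1), rule eqvI[of _ _ "- k"]) (use k neg in auto)
    qed
    show "surj A" using AA by (rule surjI)
    fix x :: cflag obtain i a b s e where x: "x = (i, a, b, s, e)" by (cases x) auto
    show "A (r0 x) = r0 (A x)" "A (r1 t x) = r1 t (A x)" "A (r2 x) = r2 (A x)"
      by (cases e; simp add: x A_def)+
  qed
  from cover_aut_aut_eq[OF this, of "(i, a, b, s, e)"] show ?thesis by (simp add: A_def)
qed

text \<open>Negation conjugates j -> \<chi> j + \<tau> to j -> \<chi> j - \<tau>, which is why
  \<tau> = 0 is assumed. Only \<open>s\<close> flips, so the class changes.\<close>

lemma aut_eq_negate:
  assumes "\<tau> = 0"
  shows "aut_eq M (code (i, a, b, s, e)) (code (i, - a, - b, \<not> s, e))"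
proof -
  define A :: "cflag \<Rightarrow> cflag" where "A = (\<lambda>(i, a, b, s, e). (i, - a, - b, \<not> s, e))"
  have AA: "A (A x) = x" for x by (cases x) (simp add: A_def)
  have "cover_aut A"
    unfolding cover_aut_def
  proof (intro conjI allI)
    have neg: "m dvd - a - glue k (- a')" if "m dvd a - glue k a'" for a a' k
    proof -
      have "- a - glue k (- a') = - (a - glue k a')" unfolding glue_def by (simp add: assms)
      then show ?thesis using that by (simp only: dvd_minus_iff)
    qed
    show "compat A" unfolding compat_def
    proof (intro allI impI)
      fix x y assume xy: "eqv x y"
      obtain i a b s e where x: "x = (i, a, b, s, e)" by (cases x) auto
      obtain i' a' b' s' e' where y: "y = (i', a', b', s', e')" by (cases y) auto
      obtain k where k: "e = e'" "i' = i + n * k" "m dvd a - glue k a'" "m dvd b - glue k b'"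
        "s = (s' = par k)" using xy by (auto simp: x y eqv_iff)
      show "eqv (A x) (A y)"
        unfolding x y A_def by (simp add: k(1), rule eqvI[of _ _ k]) (use k neg in auto)
    qed
    show "surj A" using AA by (rule surjI)
    fix x :: cflag obtain i a b s e where x: "x = (i, a, b, s, e)" by (cases x) auto
    show "A (r0 x) = r0 (A x)" "A (r1 t x) = r1 t (A x)" "A (r2 x) = r2 (A x)"
      by (cases e; simp add: x A_def)+
  qed
  from cover_aut_aut_eq[OF this, of "(i, a, b, s, e)"] show ?thesis by (simp add: A_def)
qed

lemma periodic_multiple:
  fixes x :: "int \<Rightarrow> int"
  assumes x: "\<And>i. m dvd x (i + n) - ev c * x i"
  shows "m dvd x i - sg k * x (i + n * k)"
proof (induction k arbitrary: i rule: int_induct[where k = 0])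
  case (step1 k)
  have "m dvd (x i - sg k * x (i + n * k)) - sg k * ev c * (x (i + n * k + n) - ev c * x (i + n * k))"
    by (rule dvd_diff[OF step1(2) dvd_mult[OF x]])
  moreover have "sg (k + 1) = sg k * ev c" by (auto simp: par_def ev_def)
  moreover have "(u - g * v) - g * e * (w - e * v) = u - g * e * w" if "e * e = 1" for u v w g e :: int
    using that by algebra
  moreover have "i + n * k + n = i + n * (k + 1)" by (simp add: algebra_simps)
  ultimately show ?case by (metis ev_simps(4))
next
  case (step2 k)
  have "m dvd (x i - sg k * x (i + n * k)) + sg k * (x (i + n * (k - 1) + n) - ev c * x (i + n * (k - 1)))"
    by (rule dvd_add[OF step2(2) dvd_mult[OF x]])
  moreover have "sg (k - 1) = sg k * ev c" by (auto simp: par_def ev_def)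
  moreover have "i + n * (k - 1) + n = i + n * k" by (simp add: algebra_simps)
  ultimately show ?case by (simp add: right_diff_distrib mult.assoc)
qed simp

text \<open>Adding a solution of the homogeneous recurrence carries faces to faces of the same sign.
  This allows the two ends of an edge to be moved independently.\<close>

lemma aut_eq_linear:
  fixes x :: "int \<Rightarrow> int"
  assumes rec: "\<And>i. x (i + 1) = t * x i - x (i - 1)" and per: "\<And>i. m dvd x (i + n) - ev c * x i"
  shows "aut_eq M (code (i, a, b, s, e)) (code (i, a + x i, b + x (i + 1), s, e))"
proof -
  define A :: "cflag \<Rightarrow> cflag" where "A = (\<lambda>(i, a, b, s, e). (i, a + x i, b + x (i + 1), s, e))"
  have "cover_aut A"
    unfolding cover_aut_def
  proof (intro conjI allI)
    have add: "m dvd (a + x i) - glue k (a' + x (i + n * k))" if "m dvd a - glue k a'" for a a' i k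
    proof -
      have "(a + x i) - glue k (a' + x (i + n * k)) = (a - glue k a') + (x i - sg k * x (i + n * k))"
        by (simp add: glue_def algebra_simps)
      then show ?thesis using that periodic_multiple[of x, OF per] by (simp only: dvd_add)
    qed
    show "compat A" unfolding compat_def
    proof (intro allI impI)
      fix u v assume uv: "eqv u v"
      obtain i a b s e where u: "u = (i, a, b, s, e)" by (cases u) auto
      obtain i' a' b' s' e' where v: "v = (i', a', b', s', e')" by (cases v) auto
      obtain k where k: "e = e'" "i' = i + n * k" "m dvd a - glue k a'" "m dvd b - glue k b'"
        "s = (s' = par k)" using uv by (auto simp: u v eqv_iff)
      have *: "i + n * k + 1 = i + 1 + n * k" by simp
      show "eqv (A u) (A v)"
        unfolding u v A_def prod.case k(1,2) * by (rule eqvI[OF refl add[OF k(3)] add[OF k(4)] k(5)])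
    qed
    show "surj A"
      by (rule surjI[of _ "\<lambda>(i, a, b, s, e). (i, a - x i, b - x (i + 1), s, e)"]) (auto simp: A_def)
    fix z :: cflag obtain i a b s e where z: "z = (i, a, b, s, e)" by (cases z) auto
    have "i + 1 + 1 = 2 + i" by simp
    then have 1: "x (2 + i) = t * x (i + 1) - x i" "x (i - 1) = t * x i - x (i + 1)"
      using rec[of "i + 1"] rec[of i] by (metis add_diff_cancel_right', linarith)
    show "A (r1 t z) = r1 t (A z)"
    proof (cases e)
      case True
      then show ?thesis by (simp add: z A_def 1(1) distrib_left)
    next
      case False
      then show ?thesis by (simp add: z A_def 1(2) distrib_left)
    qed
    show "A (r0 z) = r0 (A z)" "A (r2 z) = r2 (A z)"
      by (simp_all add: z A_def)
  qed
  from cover_aut_aut_eq[OF this, of "(i, a, b, s, e)"] show ?thesis by (simp add: A_def)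
qed

lemma aut_eq_normal: "aut_eq M (code (i, a, b, s, e)) (code (0, 0, 0, s \<noteq> e, False))"
proof -
  have *: "aut_eq M (code (i, a, b, s, False)) (code (0, 0, 0, s, False))" for i a b s
  proof -
    have 1: "aut_eq M (code (i, a, b, s, False)) (code (0, a, b, s, False))"
      using aut_eq_translate[of i a b s False "- i"] by simp
    obtain x :: "int \<Rightarrow> int" where "x 0 = - a" "x 1 = - b" "\<And>i. x (i + 1) = t * x i - x (i - 1)"
      "\<And>i. m dvd x (i + n) - ev c * x i" using sol by metis
    then have "aut_eq M (code (0, a, b, s, False)) (code (0, 0, 0, s, False))"
      using aut_eq_linear[of x 0 a b s False] by simp
    with 1 show ?thesis by (rule aut_eq_trans)
  qed
  show ?thesis
  proof (cases e)
    \<comment> \<open>The half-turn makes the upper end a lower one and flips \<open>s\<close>, so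
      the sign afterwards is \<open>s \<noteq> e\<close>.\<close>
    case True
    then show ?thesis
      using aut_eq_trans[OF aut_eq_rotate[of i a b s True, simplified] *] by simp
  qed (use * in simp)
qed

lemma aut_eq_cls: "cls x = cls y \<Longrightarrow> aut_eq M (code x) (code y)"
proof -
  assume cls: "cls x = cls y"
  have norm: "aut_eq M (code z) (code (0, 0, 0, cls z, False))" for z
    using aut_eq_normal by (cases z) simp
  have "aut_eq M (code (0, 0, 0, cls x, False)) (code y)"
    unfolding cls by (rule aut_eq_sym[OF _ norm]) simp
  with norm show ?thesis by (rule aut_eq_trans)
qed

lemma rotaryM: "rotary M"
  by (rule rotaryI) (auto intro!: aut_eq_cls simp del: cls.simps r0.simps r1.simps r2.simps)

lemma reflexibleM:
  assumes "\<tau> = 0"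
  shows "reflexible M"
proof (rule reflexibleI)
  fix u v assume "u \<in> flg M" "v \<in> flg M"
  then obtain x y where xy: "u = code x" "v = code y" by auto
  obtain i a b s e where x: "x = (i, a, b, s, e)" by (cases x) auto
  show "aut_eq M u v"
  proof (cases "cls x = cls y")
    case False
    have "aut_eq M u (code (i, - a, - b, \<not> s, e))" using aut_eq_negate[OF assms] by (simp add: xy x)
    moreover have "aut_eq M (code (i, - a, - b, \<not> s, e)) v"
      unfolding xy by (rule aut_eq_cls) (use False in \<open>auto simp: x\<close>)
    ultimately show ?thesis by (rule aut_eq_trans)
  qed (simp add: xy aut_eq_cls)
qed

section \<open>Orientability\<close>

lemma cls_eqv:
  assumes c "eqv x y"
  shows "cls x = cls y"
proof -
  obtain i a b s e where x: "x = (i, a, b, s, e)" by (cases x) auto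
  obtain i' a' b' s' e' where y: "y = (i', a', b', s', e')" by (cases y) auto
  have "par k" for k unfolding par_def using assms(1) by (rule disjI1)
  then show ?thesis using assms(2) unfolding x y eqv_iff by auto
qed

definition col :: "nat \<Rightarrow> bool" where
  "col u = cls (inv code u)"

lemma col_code:
  assumes c
  shows "col (code x) = cls x"
proof -
  have "eqv (inv code (code x)) x" by (simp add: code_eq_iff[symmetric] f_inv_into_f)
  then show ?thesis unfolding col_def by (rule cls_eqv[OF assms])
qed

lemma orientableM:
  assumes c
  shows "orientable M"
  unfolding orientable_def
  by (rule exI[of _ col]) (auto simp: col_code[OF assms] simp del: cls.simps r0.simps r1.simps r2.simps)

text \<open>Words of even length preserve a two-colouring. Such words lead once around the cycle
  from a flag to the flag that the gluing identifies with its \<open>r2\<close>-image, which has the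
  other colour.\<close>

lemma not_orientableM:
  assumes "\<not> c"
  shows "\<not> orientable M"
proof
  assume "orientable M"
  from this[unfolded orientable_def] obtain f :: "nat \<Rightarrow> bool" where f': "\<forall>x\<in>flg M. f (rz M x) \<noteq> f x \<and> f (ro M x) \<noteq> f x \<and> f (rt M x) \<noteq> f x" ..
  have f: "f (code (r0 x)) = (\<not> f (code x))" "f (code (r1 t x)) = (\<not> f (code x))"
    "f (code (r2 x)) = (\<not> f (code x))" for x
    using bspec[OF f', of "code x"] by simp_all
  have b: "f (code (i, a, b', s, False)) = f (code (i, a, b, s, False))" for i a b b' s
  proof (rule rotation_induct[where b = b and P = "\<lambda>u. f u = f (code (i, a, b, s, False))"])
    have "f (code (i, a, b' + 2 * ev s, s, False)) = f (code (i, a, b', s, False))" for b'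
      by (simp only: f not_not flip: rotate_r12)
    then show "f (code (i, a, b' + 2 * ev s, s, False)) = f (code (i, a, b, s, False))"
      if "f (code (i, a, b', s, False)) = f (code (i, a, b, s, False))" for b' using that by simp
  qed (rule refl)
  have succ: "f (code (i, a, b, s, False)) = f (code (i + 1, 0, 0, s, False))" for i a b s
  proof -
    have "f (code (i, a, b, s, False)) = f (code (i, a, 0, s, False))" by (rule b)
    also have "\<dots> = f (code (r1 t (r0 (i, a, 0, s, False))))" by (simp only: f not_not)
    also have "\<dots> = f (code (i + 1, 0, 0, s, False))" by (simp add: b[of "i + 1" 0 "ev s - a" s 0])
    finally show ?thesis .
  qed
  have "f (code (int k, 0, 0, True, False)) = f (code (0, 0, 0, True, False))" for k
    by (induction k) (use succ[of "int _" 0 0 True] in \<open>simp_all add: add.commute\<close>)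
  from this[of "nat n"] have "f (code (n, 0, 0, True, False)) = f (code (0, 0, 0, True, False))"
    using n3 by simp
  moreover have "code (n, 0, 0, True, False) = code (r2 (0, 0, 0, True, False))"
    unfolding code_eq_iff r2.simps by (rule eqvI[of _ _ "-1"]) (unfold par_def glue_def, use assms c\<tau> in auto)
  ultimately show False by (simp only: f) blast
qed

end

section \<open>Faces and chirality\<close>

context twisted_map
begin

lemma card_mverts: "card (mverts M) = nat n * nat m"
  using bij_betw_same_card[OF bij_vname] by (simp add: card_cartesian_product)

text \<open>Automorphisms may be confined to one class, but \<open>rz\<close> keeps the face and
  \<open>rt\<close> keeps the vertex, so data of faces and vertices can still be transported to
  every flag.\<close>

lemma aut_eq_or_flip:
  assumes "u \<in> flg M"
  shows "aut_eq M (code x) u \<or> aut_eq M (code x) (rz M u)" "aut_eq M (code x) u \<or> aut_eq M (code x) (rt M u)"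
proof -
  obtain z where z: "u = code z" using assms by auto
  show "aut_eq M (code x) u \<or> aut_eq M (code x) (rz M u)" "aut_eq M (code x) u \<or> aut_eq M (code x) (rt M u)"
    using aut_eq_cls[of x z] aut_eq_cls[of x "r0 z"] aut_eq_cls[of x "r2 z"] unfolding z M_code cls_r by blast+
qed

text \<open>All vertices have equally many flags, so their number is 4 n m^2 divided by the n m
  vertices.\<close>

lemma card_vorb:
  assumes u: "u \<in> flg M"
  shows "card (vorb M u) = 4 * nat m"
proof -
  fix x0 :: cflag
  have const: "card (vorb M u) = card (vorb M (code x0))" if u: "u \<in> flg M" for u
  proof -
    have "aut_eq M (code x0) v \<Longrightarrow> card (vorb M v) = card (vorb M (code x0))" for v
      by (auto simp: aut_eq_def card_orb_map_aut)
    then show ?thesis using aut_eq_or_flip(2)[OF u, of x0] orb_step(2)[OF u] by metis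
  qed
  then have "card (vorb M (code x0)) * card (mverts M) = card (flg M)" by (rule card_orbits(1))
  then have "card (vorb M (code x0)) * (nat n * nat m) = (4 * nat m) * (nat n * nat m)"
    by (simp only: card_mverts card_flgM mult_ac)
  moreover have "nat n * nat m \<noteq> 0" using n3 m3 by simp
  ultimately have "card (vorb M (code x0)) = 4 * nat m" by (metis mult_right_cancel)
  then show ?thesis using const[OF u] by simp
qed

lemma vert_valency: "v \<in> mverts M \<Longrightarrow> card (vert_edges M v) = 2 * nat m"
  using card_vert_edges[OF _ no_loop] card_vorb by (force simp: mverts_def)

context
  fixes y :: "int \<Rightarrow> int" and p :: nat
  assumes rec: "\<And>k. m dvd y (k + 1) - (t * y k - y (k - 1) + 1)"
    and p3: "p \<ge> 3"
    and per: "code (int p, y (int p), y (int p + 1), True, False) = code (0, y 0, y 1, True, False)"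
    and inj: "inj_on (\<lambda>k. lab (int k) (y (int k))) {..<p}"
begin

abbreviation x0 :: nat where
  "x0 \<equiv> code (0, y 0, y 1, True, False)"

lemma phi_code: "((\<lambda>z. ro M (rz M z)) ^^ k) x0 = code (int k, y (int k), y (int k + 1), True, False)"
proof (induction k)
  case (Suc k)
  have "code (int k + 1, y (int k + 1), t * y (int k + 1) - y (int k) + 1, True, False)
      = code (int k + 1, y (int k + 1), y (int k + 1 + 1), True, False)"
    using rec[of "int k + 1"] by (intro code_cong) (simp_all add: dvd_diff_commute)
  then show ?case using Suc by (simp add: add.commute)
qed simp

lemma base_face:
  "card (forb M x0) = 2 * p" "card (face_verts M (forb M x0)) = p" "card (face_edges M (forb M x0)) = p"
  "rt M x0 \<notin> forb M x0"
proof -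
  have V: "inj_on (\<lambda>k. vorb M (((\<lambda>z. ro M (rz M z)) ^^ k) x0)) {..<p}"
    using inj unfolding phi_code by (simp add: inj_on_def vorb_eq_iff)
  have E: "inj_on (\<lambda>k. eorb M (((\<lambda>z. ro M (rz M z)) ^^ k) x0)) {..<p}"
    using inj unfolding phi_code by (simp add: inj_on_def eorb_code_iff)
  have x0: "x0 \<in> flg M" by simp
  have p0: "p > 0" using p3 by simp
  have per': "((\<lambda>z. ro M (rz M z)) ^^ p) x0 = x0" unfolding phi_code by (rule per)
  note base = x0 p0 per' V E
  show "card (forb M x0) = 2 * p" "card (face_verts M (forb M x0)) = p" "card (face_edges M (forb M x0)) = p"
    using card_face_phi[OF base] by blast+
  \<comment> \<open>Along a face the gluing may swap signs, so the sign alone does not separate the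
    flags: \<open>e\<close> excludes the \<open>rz\<close>-images, distinctness of the vertices
    excludes positive \<open>k\<close>, and at \<open>k = 0\<close> the signs differ.\<close>
  show "rt M x0 \<notin> forb M x0"
  proof
    assume "rt M x0 \<in> forb M x0"
    then obtain k where k: "k < p"
      "code (0, y 0, y 1, False, False) = code (int k, y (int k), y (int k + 1), True, False) \<or>
       code (0, y 0, y 1, False, False) = code (int k, y (int k), y (int k + 1), True, True)"
      unfolding forb_phi[OF base] phi_code by auto
    then have eq: "code (0, y 0, y 1, False, False) = code (int k, y (int k), y (int k + 1), True, False)"
      unfolding code_eq_iff eqv_iff by blast
    then have "lab 0 (y 0) = lab (int k) (y (int k))"
      unfolding code_eq_iff using vlab_eqv by force
    then have "k = 0" using inj_onD[OF inj, of 0 k] k(1) by simp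
    then show False using eq n3 by (simp add: code_eq_iff eqv_iff)
  qed
qed

text \<open>Replacing \<open>u\<close> by \<open>rz M u\<close> changes neither of the two faces at
  the edge, because \<open>rz\<close> commutes with \<open>rt\<close>.\<close>

lemma face_transport:
  assumes "u \<in> flg M"
  obtains a where "map_aut M a" "a x0 \<in> flg M" "forb M u = forb M (a x0)" "forb M (rt M u) = forb M (rt M (a x0))"
proof -
  from aut_eq_or_flip(1)[OF assms, of "(0, y 0, y 1, True, False)"]
  obtain a where a: "map_aut M a" "a x0 = u \<or> a x0 = rz M u" by (auto simp: aut_eq_def)
  have "forb M (rt M (rz M u)) = forb M (rt M u)"
    using flg_fixfree(4)[OF assms] orb_step(5)[OF flg_closed(3)[OF assms]] by simp
  then show ?thesis
    using that[OF a(1)] a(2) assms flg_closed(1)[OF assms] orb_step(5)[OF assms] by metis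
qed

lemma face_cards:
  assumes "u \<in> flg M"
  shows "card (forb M u) = 2 * p" "card (face_verts M (forb M u)) = p" "card (face_edges M (forb M u)) = p"
    "forb M u \<noteq> forb M (rt M u)"
proof -
  obtain a where a: "map_aut M a" "a x0 \<in> flg M" "forb M u = forb M (a x0)" "forb M (rt M u) = forb M (rt M (a x0))"
    using face_transport[OF assms] by blast
  have x0: "x0 \<in> flg M" by simp
  show "card (forb M u) = 2 * p" "card (face_verts M (forb M u)) = p" "card (face_edges M (forb M u)) = p"
    unfolding a(3) using card_orb_map_aut[OF a(1) x0] card_face_map_aut[OF a(1) x0] base_face by simp_all
  have "rt M (a x0) = a (rt M x0)" using a(1) x0 unfolding map_aut_def by metis
  moreover have "a (rt M x0) \<notin> forb M (a x0)"
  proof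
    assume "a (rt M x0) \<in> forb M (a x0)"
    then obtain w where w: "w \<in> forb M x0" "a (rt M x0) = a w"
      using orb_map_aut(3)[OF a(1) x0] by blast
    moreover have "w \<in> flg M" using w(1) orb_subset(3)[OF x0] by blast
    ultimately have "rt M x0 = w" using map_aut_inj[OF a(1)] flg_closed(3)[OF x0] by (meson inj_onD)
    then show False using w(1) base_face(4) by blast
  qed
  ultimately show "forb M u \<noteq> forb M (rt M u)"
    unfolding a(3,4) using orb_eq_iff(3)[OF a(2)] by metis
qed

lemma polytopalM: "polytopal M"
  unfolding polytopal_def mfaces_def using face_cards p3 by auto

lemma map_typeM: "map_type M p (2 * nat m)"
  unfolding map_type_def using face_cards(3) vert_valency by (auto simp: mfaces_def)

text \<open>\<open>q\<close> is the number of faces: the 4 n m^2 flags are distributed over faces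
  with 2 p flags each.\<close>

lemma euler_charM:
  assumes "p * q = 2 * nat n * nat m * nat m"
  shows "euler_char M = n * m - n * m * m + int q"
proof -
  have "2 * p * card (mfaces M) = card (flg M)" by (rule card_orbits(3)) (rule face_cards(1))
  moreover have "card (flg M) = 2 * p * q" unfolding card_flgM mult.assoc assms[unfolded mult.assoc] by simp
  ultimately have "2 * p * card (mfaces M) = 2 * p * q" by simp
  then have "card (mfaces M) = q" using p3 by simp
  moreover have "4 * card (medges M) = card (flg M)" by (rule card_orbits(2)) (rule card_eorb)
  then have "card (medges M) = nat n * nat m * nat m" unfolding card_flgM by simp
  ultimately show ?thesis unfolding euler_char_def card_mverts using n3 m3 by simp
qed

end

section \<open>Chirality\<close>

lemma rotate_r12_True: "r1 t (r2 (r1 t (r2 (i, a, b, s, True)))) = (i, a + 2 * ev s, b, s, True)"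
  by (simp add: algebra_simps)

lemma map_aut_funpow:
  assumes "\<And>u. u \<in> flg M \<Longrightarrow> f u \<in> flg M" "\<And>u. u \<in> flg M \<Longrightarrow> a (f u) = f (a u)" "u \<in> flg M"
  shows "(f ^^ k) u \<in> flg M \<and> a ((f ^^ k) u) = (f ^^ k) (a u)"
  by (induction k) (simp_all add: assms del: M_code(1))

text \<open>\<open>W\<close> and \<open>?phi ^^ nat n\<close> are words in the three involutions and
  thus commute with automorphisms. They agree at a flag over the origin with sign +, but with sign -
  they shift the fibres by -1 and +1, which differ because \<open>m\<close> does not divide
  2.\<close>

lemma not_reflexibleM:
  assumes t: "t = 2" and c: c and \<tau>: "\<tau> = 1" and mn: "m dvd n"
  shows "\<not> reflexible M"
proof (rule not_reflexibleI[of col])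
  show "col (rz M z) \<noteq> col z \<and> col (ro M z) \<noteq> col z" if "z \<in> flg M" for z
    using that by (auto simp: col_code[OF c] simp del: cls.simps r0.simps r1.simps r2.simps)
  let ?phi = "\<lambda>z. ro M (rz M z)" and ?sig = "\<lambda>z. ro M (rt M (ro M (rt M z)))"
  obtain h where h: "m = 2 * h + 1" using oddm by (rule oddE)
  then have h0: "h \<ge> 0" using m3 by simp
  \<comment> \<open>\<open>k\<close> is the inverse of 2 modulo \<open>m\<close>, so
    \<open>?sig ^^ k\<close> shifts by a single \<open>ev s\<close>.\<close>
  define k where "k = nat (h + 1)"
  have k: "2 * int k = m + 1" using h h0 by (simp add: k_def)
  \<comment> \<open>On flags at the lower end of an edge, \<open>W\<close> adds \<open>ev s\<close> to both \<open>a\<close> and \<open>b\<close>, while \<open>?phi ^^ n\<close> adds 1.\<close>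
  define W where "W = (\<lambda>z. rz M ((?sig ^^ k) (rz M ((?sig ^^ k) z))))"
  have sigF: "(?sig ^^ j) (code (i, a, b, s, False)) = code (i, a, b + 2 * ev s * int j, s, False)" for i a b s j
    by (induction j) (simp_all only: funpow.simps comp_apply id_apply M_code rotate_r12, simp_all add: algebra_simps)
  have sigT: "(?sig ^^ j) (code (i, a, b, s, True)) = code (i, a + 2 * ev s * int j, b, s, True)" for i a b s j
    by (induction j) (simp_all only: funpow.simps comp_apply id_apply M_code rotate_r12_True, simp_all add: algebra_simps)
  have W: "W (code (0, 0, 0, s, False)) = code (0, ev s, ev s, s, False)" for s
  proof -
    have "2 * ev s * int k = ev s * (2 * int k)" by simp
    also have "\<dots> = ev s + m * ev s" unfolding k by (simp add: distrib_left)
    finally show ?thesis unfolding W_def by (simp add: sigF sigT) (rule code_cong; simp)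
  qed
  \<comment> \<open>The triangular numbers describe the face through the origin for t = 2; they
    vanish modulo \<open>m\<close> at \<open>n\<close> and \<open>n + 1\<close>, so only \<tau>
    remains after one turn.\<close>
  define T where "T j = (\<Sum>i<j. int i)" for j
  have phi: "(?phi ^^ j) (code (0, 0, 0, s, False)) = code (int j, ev s * T j, ev s * T (Suc j), s, False)" for j s
  proof (induction j)
    case (Suc j)
    have "t * (ev s * T (Suc j)) - ev s * T j + ev s = ev s * T (Suc (Suc j))"
      unfolding t T_def by (simp add: algebra_simps)
    then show ?case using Suc by (simp add: add.commute)
  qed (simp add: T_def)
  have "2 * T j = int j * (int j - 1)" for j
    by (induction j) (simp_all add: T_def algebra_simps)
  then have "m dvd 2 * T (nat n)" "m dvd 2 * T (Suc (nat n))"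
    using mn n3 by simp_all
  moreover have "coprime m 2" using oddm by simp
  ultimately have mT: "m dvd T (nat n)" "m dvd T (Suc (nat n))"
    by (simp_all only: coprime_dvd_mult_right_iff)
  have par: "par j" for j unfolding par_def using c by (rule disjI1)
  have glue1: "glue (- 1) 1 = 0" unfolding glue_def unfolding \<tau> by (simp add: par)
  have phin: "(?phi ^^ nat n) (code (0, 0, 0, s, False)) = code (0, 1, 1, s, False)" for s
    unfolding phi code_eq_iff by (rule eqvI[of _ _ "-1"]) (use mT n3 in \<open>simp_all add: par glue1\<close>)
  have no: "\<not> aut_eq M (code (0, 0, 0, True, False)) (code (0, 0, 0, False, False))"
  proof
    assume "aut_eq M (code (0, 0, 0, True, False)) (code (0, 0, 0, False, False))"
    then obtain a where a: "map_aut M a" "a (code (0, 0, 0, True, False)) = code (0, 0, 0, False, False)"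
      by (auto simp: aut_eq_def)
    have comm: "a (rz M u) = rz M (a u)" "a (ro M u) = ro M (a u)" "a (rt M u) = rt M (a u)" if "u \<in> flg M" for u
      using a(1) that unfolding map_aut_def by blast+
    have phia: "a ((?phi ^^ j) u) = (?phi ^^ j) (a u)" if "u \<in> flg M" for u j
      using map_aut_funpow[of ?phi a u j] that comm by (simp del: M_code(1))
    have siga: "(?sig ^^ j) u \<in> flg M \<and> a ((?sig ^^ j) u) = (?sig ^^ j) (a u)" if "u \<in> flg M" for u j
      using map_aut_funpow[of ?sig a u j] that comm by (simp del: M_code(1))
    have Wa: "a (W u) = W (a u)" if u: "u \<in> flg M" for u
      unfolding W_def using siga[OF u, of k] siga[of "rz M ((?sig ^^ k) u)" k] comm(1) flg_closed(1) by metis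
    have "W (code (0, 0, 0, True, False)) = (?phi ^^ nat n) (code (0, 0, 0, True, False))"
      unfolding W phin by simp
    then have "W (a (code (0, 0, 0, True, False))) = (?phi ^^ nat n) (a (code (0, 0, 0, True, False)))"
      using Wa phia by (metis M_code(1) rangeI)
    then have "eqv (0, - 1, - 1, False, False) (0, 1, 1, False, False)"
      unfolding a(2) W phin code_eq_iff by simp
    then obtain j where "0 = n * j" "m dvd - 1 - glue j 1" unfolding eqv_iff by auto
    then have "m dvd 2" using n3 by auto
    then show False using m3 by (simp add: zdvd_not_zless)
  qed
  show "col u = col v" if u: "u \<in> flg M" "v \<in> flg M" "aut_eq M u v" for u v
  proof (rule ccontr)
    obtain x y where xy: "u = code x" "v = code y" using u by auto
    assume "col u \<noteq> col v"
    then have ne: "cls x \<noteq> cls y" by (simp add: xy col_code[OF c])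
    have "aut_eq M (code (0, 0, 0, cls x, False)) u" "aut_eq M v (code (0, 0, 0, cls y, False))"
      unfolding xy by (rule aut_eq_cls; simp)+
    then have *: "aut_eq M (code (0, 0, 0, cls x, False)) (code (0, 0, 0, cls y, False))"
      using aut_eq_trans u(3) by metis
    show False
    proof (cases "cls x")
      case True
      then show False using * ne no by simp
    next
      case False
      then show False using aut_eq_sym[OF _ *] ne no by simp
    qed
  qed
qed

end

section \<open>The three maps\<close>

text \<open>A particular solution of the recurrence with t = 2 and sign +, whose second difference
  is constantly 1.\<close>

definition tri :: "int \<Rightarrow> int" where
  "tri k = k * (k - 1) div 2"

lemma two_tri: "2 * tri k = k * (k - 1)"
  unfolding tri_def by (rule dvd_mult_div_cancel) simp

lemma tri_rec: "tri (k + 1) = 2 * tri k - tri (k - 1) + 1"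
proof -
  have "2 * tri (k + 1) = 2 * (2 * tri k - tri (k - 1) + 1)"
    unfolding ring_distribs two_tri by (simp add: two_tri algebra_simps)
  then show ?thesis by simp
qed

lemma tri_0_1 [simp]: "tri 0 = 0" "tri 1 = 0"
  by (simp_all add: tri_def)

lemma dvd_tri:
  assumes "odd m" "m dvd k"
  shows "m dvd tri k" "m dvd tri (k + 1)"
proof -
  have "m dvd 2 * tri k" "m dvd 2 * tri (k + 1)" unfolding two_tri using assms(2) by simp_all
  moreover have "coprime m 2" using assms(1) by simp
  ultimately show "m dvd tri k" "m dvd tri (k + 1)" by (simp_all only: coprime_dvd_mult_right_iff)
qed

lemma dvd_tri_diff:
  assumes "odd m" "m dvd j - k"
  shows "m dvd tri j - tri k"
proof -
  have "2 * (tri j - tri k) = (j - k) * (j + k - 1)"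
    by (simp only: right_diff_distrib two_tri) (simp add: algebra_simps)
  then have "m dvd 2 * (tri j - tri k)" using assms(2) by simp
  moreover have "coprime m 2" using assms(1) by simp
  ultimately show ?thesis by (simp only: coprime_dvd_mult_right_iff)
qed

section \<open>Closing up one face for each choice of parameters\<close>

context twisted_map
begin

lemma tri_rec': "t = 2 \<Longrightarrow> m dvd tri (k + 1) - (t * tri k - tri (k - 1) + 1)"
  using tri_rec[of k] by simp

text \<open>Since \<open>tri\<close> depends only on the residue modulo \<open>m\<close>, which
  divides \<open>n\<close>, each turn merely shifts the fibre by 1. Two equal vertices therefore
  differ by a number \<open>l\<close> of turns divisible by \<open>m\<close>, while fewer than m n
  steps force \<open>l\<close> to lie strictly between -m and m.\<close>

lemma chiral_map:
  assumes t: "t = 2" and c: c and \<tau>: "\<tau> = 1" and mn: "m dvd n"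
  shows "polytopal M" "chiral M" "map_type M (nat m * nat n) (2 * nat m)"
    "euler_char M = n * m - n * m * m + 2 * m"
proof -
  have par: "par j" for j unfolding par_def using c by (rule disjI1)
  have glue: "glue k j = j + k" for k j unfolding glue_def unfolding \<tau> by (simp add: par)
  have p: "int (nat m * nat n) = m * n" using m3 n3 by simp
  have p3: "nat m * nat n \<ge> 3"
  proof -
    have "3 * 1 \<le> nat m * nat n" by (rule mult_le_mono) (use m3 n3 in auto)
    then show ?thesis by simp
  qed
  have per: "code (int (nat m * nat n), tri (int (nat m * nat n)), tri (int (nat m * nat n) + 1), True, False)
      = code (0, tri 0, tri 1, True, False)"
    unfolding code_eq_iff p
    by (rule eqvI[of _ _ "- m"]) (use dvd_tri[OF oddm, of "m * n"] in \<open>simp_all add: par glue\<close>)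
  have inj: "inj_on (\<lambda>k. lab (int k) (tri (int k))) {..<nat m * nat n}"
  proof (rule inj_onI)
    fix j k assume jk: "j \<in> {..<nat m * nat n}" "k \<in> {..<nat m * nat n}"
      "lab (int j) (tri (int j)) = lab (int k) (tri (int k))"
    obtain l where l: "int k = int j + n * l" "m dvd tri (int j) - (tri (int k) + l)"
      using jk(3) unfolding lab_eq_iff glue by blast
    have "m dvd int j - int k" using l(1) mn by simp
    then have "m dvd tri (int j) - tri (int k)" by (rule dvd_tri_diff[OF oddm])
    then have "m dvd (tri (int j) - tri (int k)) - (tri (int j) - (tri (int k) + l))" using l(2) by (rule dvd_diff)
    then have "m dvd l" by simp
    have "int j < m * n" "int k < m * n" using jk(1,2) p by (metis lessThan_iff of_nat_less_iff)+
    then have "n * l < n * m" "n * (- l) < n * m" using l(1) by (simp_all add: mult.commute)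
    then have "l < m" "- l < m" using n3 by (simp_all only: mult_less_cancel_left_pos)
    then have "\<bar>l\<bar> < \<bar>m\<bar>" by auto
    then have "l = 0" using \<open>m dvd l\<close> by (meson dvd_imp_le_int not_le)
    then show "j = k" using l(1) by simp
  qed
  note face = tri_rec'[OF t] p3 per inj
  show "polytopal M" by (rule polytopalM[OF face])
  show "map_type M (nat m * nat n) (2 * nat m)" by (rule map_typeM[OF face])
  have "euler_char M = n * m - n * m * m + int (2 * nat m)" by (rule euler_charM[OF face]) simp
  then show "euler_char M = n * m - n * m * m + 2 * m" using m3 by simp
  show "chiral M"
    unfolding chiral_def using rotaryM orientableM[OF c] not_reflexibleM[OF t c \<tau> mn] by blast
qed

text \<open>Without translation the face closes after one turn, during which its vertices lie in
  distinct fibres.\<close>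

lemma orientable_map:
  assumes t: "t = 2" and c: c and \<tau>: "\<tau> = 0" and mn: "m dvd n"
  shows "polytopal M" "reflexible M" "orientable M" "map_type M (nat n) (2 * nat m)"
    "euler_char M = n * m - n * m * m + 2 * m * m"
proof -
  have par: "par j" for j unfolding par_def using c by (rule disjI1)
  have glue: "glue k j = j" for k j unfolding glue_def unfolding \<tau> by (simp add: par)
  have p: "int (nat n) = n" using n3 by simp
  have p3: "nat n \<ge> 3" using n3 by simp
  have per: "code (int (nat n), tri (int (nat n)), tri (int (nat n) + 1), True, False)
      = code (0, tri 0, tri 1, True, False)"
    unfolding code_eq_iff p
    by (rule eqvI[of _ _ "- 1"]) (use dvd_tri[OF oddm mn] in \<open>simp_all add: par glue\<close>)
  have inj: "inj_on (\<lambda>k. lab (int k) (tri (int k))) {..<nat n}"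
    by (rule inj_onI) (auto simp: lab_def)
  note face = tri_rec'[OF t] p3 per inj
  show "polytopal M" by (rule polytopalM[OF face])
  show "map_type M (nat n) (2 * nat m)" by (rule map_typeM[OF face])
  have "euler_char M = n * m - n * m * m + int (2 * nat m * nat m)" by (rule euler_charM[OF face]) simp
  then show "euler_char M = n * m - n * m * m + 2 * m * m" using m3 by simp
  show "reflexible M" "orientable M" by (rule reflexibleM[OF \<tau>], rule orientableM[OF c])
qed

text \<open>The congruence for \<open>d\<close> says that the constant sequence \<open>d\<close> is
  a face of sign +. Two turns restore both its value and its sign.\<close>

lemma nonorientable_map:
  assumes c: "\<not> c" and d: "m dvd (2 - t) * d - 1"
  shows "polytopal M" "reflexible M" "\<not> orientable M" "map_type M (2 * nat n) (2 * nat m)"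
    "euler_char M = n * m - n * m * m + m * m"
proof -
  have \<tau>: "\<tau> = 0" using c c\<tau> by blast
  have par: "par j \<longleftrightarrow> even j" for j unfolding par_def using c by blast
  have glue: "glue k j = ev (even k) * j" for k j unfolding glue_def par unfolding \<tau> by simp
  have p: "int (2 * nat n) = 2 * n" using n3 by simp
  have p3: "2 * nat n \<ge> 3" using n3 by simp
  have per: "code (int (2 * nat n), d, d, True, False) = code (0, d, d, True, False)"
    unfolding code_eq_iff p by (rule eqvI[of _ _ "- 2"]) (simp_all add: par glue)
  have inj: "inj_on (\<lambda>k. lab (int k) d) {..<2 * nat n}"
  proof (rule inj_onI)
    fix j k assume jk: "j \<in> {..<2 * nat n}" "k \<in> {..<2 * nat n}" "lab (int j) d = lab (int k) d"
    obtain l where l: "int k = int j + n * l" "m dvd d - ev (even l) * d"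
      using jk(3) unfolding lab_eq_iff glue by blast
    \<comment> \<open>An odd number of turns would identify \<open>d\<close> with
      \<open>- d\<close>, impossible for a unit modulo the odd number \<open>m\<close>.\<close>
    have "even l"
    proof (rule ccontr)
      assume "odd l"
      then have "m dvd 2 * d" using l(2) by simp
      moreover have "coprime m 2" using oddm by simp
      ultimately have "m dvd d" by (simp only: coprime_dvd_mult_right_iff)
      then have "m dvd (2 - t) * d - ((2 - t) * d - 1)" by (intro dvd_diff[OF _ d]) simp
      then show False using m3 by (simp add: zdvd_not_zless)
    qed
    have "int j < 2 * n" "int k < 2 * n" using jk(1,2) n3 by auto
    then have "n * l < n * 2" "n * (- l) < n * 2" using l(1) unfolding mult_minus_right by linarith+
    then have "l < 2" "- l < 2" using n3 by (simp_all only: mult_less_cancel_left_pos)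
    then have "l = 0" using \<open>even l\<close> by presburger
    then show "j = k" using l(1) by simp
  qed
  have rec: "m dvd d - (t * d - d + 1)" using d by (simp add: algebra_simps)
  note face = polytopalM[of "\<lambda>_. d", OF rec p3 per inj] map_typeM[of "\<lambda>_. d", OF rec p3 per inj]
    euler_charM[of "\<lambda>_. d", OF rec p3 per inj]
  show "polytopal M" by (rule face(1))
  show "map_type M (2 * nat n) (2 * nat m)" by (rule face(2))
  have "euler_char M = n * m - n * m * m + int (nat m * nat m)" by (rule face(3)) simp
  then show "euler_char M = n * m - n * m * m + m * m" using m3 by simp
  show "reflexible M" "\<not> orientable M" by (rule reflexibleM[OF \<tau>], rule not_orientableM[OF c])
qed

end

lemma twisted_map_2:
  fixes n m \<tau> :: int
  assumes "n \<ge> 3" "m \<ge> 3" "odd m" "m dvd n"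
  shows "twisted_map n m 2 \<tau> True"
proof
  fix a b :: int
  show "\<exists>x :: int \<Rightarrow> int. x 0 = a \<and> x 1 = b \<and> (\<forall>i. x (i + 1) = 2 * x i - x (i - 1)) \<and>
      (\<forall>i. m dvd x (i + n) - ev True * x i)"
  proof (intro exI conjI allI)
    \<comment> \<open>For t = 2 the solutions are the linear functions; over one turn they grow by a
      multiple of \<open>n\<close>, hence of \<open>m\<close>.\<close>
    let ?x = "\<lambda>i. a + (b - a) * i"
    show "?x (i + 1) = 2 * ?x i - ?x (i - 1)" for i by (simp add: algebra_simps)
    have "?x (i + n) - ev True * ?x i = (b - a) * n" for i by (simp add: algebra_simps)
    then show "m dvd ?x (i + n) - ev True * ?x i" for i using assms(4) by simp
  qed simp_all
qed (use assms in simp_all)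

text \<open>Multiplying a solution for t = 2 by (-1)^i gives one for t = -2, and an odd
  \<open>n\<close> contributes the factor -1.\<close>

lemma twisted_map_minus_2:
  fixes n m :: int
  assumes "n \<ge> 3" "m \<ge> 3" "odd m" "m dvd n" "odd n"
  shows "twisted_map n m (-2) 0 False"
proof
  fix a b :: int
  show "\<exists>x :: int \<Rightarrow> int. x 0 = a \<and> x 1 = b \<and> (\<forall>i. x (i + 1) = - 2 * x i - x (i - 1)) \<and>
      (\<forall>i. m dvd x (i + n) - ev False * x i)"
  proof (intro exI conjI allI)
    let ?x = "\<lambda>i. ev (even i) * (a - (a + b) * i)"
    show "?x (i + 1) = - 2 * ?x i - ?x (i - 1)" for i :: int by (cases "even i") (simp_all add: algebra_simps)
    have "?x (i + n) - ev False * ?x i = - ev (even (i + n)) * (a + b) * n" for i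
      using assms(5) by (cases "even i") (simp_all add: algebra_simps)
    then show "m dvd ?x (i + n) - ev False * ?x i" for i using assms(4) by (metis dvd_mult)
  qed simp_all
qed (use assms in simp_all)

text \<open>For t = 0 the solutions run through a, b, -a, -b with period 4, so a shift by twice an
  odd number negates them.\<close>

lemma twisted_map_0:
  fixes n m :: int
  assumes "n \<ge> 3" "m \<ge> 3" "odd m" "n = 2 * q" "odd q"
  shows "twisted_map n m 0 0 False"
proof
  fix a b :: int
  show "\<exists>x :: int \<Rightarrow> int. x 0 = a \<and> x 1 = b \<and> (\<forall>i. x (i + 1) = 0 * x i - x (i - 1)) \<and>
      (\<forall>i. m dvd x (i + n) - ev False * x i)"
  proof (intro exI conjI allI)
    let ?x = "\<lambda>i. ev (even (i div 2)) * (if even i then a else b)"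
    show "?x (i + 1) = 0 * ?x i - ?x (i - 1)" for i :: int
    proof -
      have "(i + 1) div 2 = (i - 1) div 2 + 1" by simp
      then have "ev (even ((i + 1) div 2)) = - ev (even ((i - 1) div 2))" by (simp add: ev_def)
      moreover have "even (i + 1) = even (i - 1)" by simp
      ultimately show ?thesis by simp
    qed
    have "?x (i + n) - ev False * ?x i = 0" for i :: int
    proof -
      have "(i + n) div 2 = i div 2 + q" "even (i + n) = even i" unfolding assms(4) by simp_all
      moreover from this(1) assms(5) have "ev (even ((i + n) div 2)) = - ev (even (i div 2))" by (simp add: ev_def)
      ultimately show ?thesis by simp
    qed
    then show "m dvd ?x (i + n) - ev False * ?x i" for i by simp
  qed simp_all
qed (use assms in simp_all)

theorem theorem1p1:
  fixes s m n :: nat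
  assumes "s > 0" and "\<not> 4 dvd s" and "odd m" and "m \<ge> 3" and "n = s * m"
  shows
   "(\<exists>M :: nat fmap. fmap_wf M \<and> polytopal M \<and> chiral M \<and>
        skeleton_is M ({0..<n} \<times> {0..<m}) (lexcyc_adj n m) \<and>
        map_type M (m * n) (2 * m) \<and>
        euler_char M = 2 - 2 * (1 + int m * (int n * ((int m - 1) div 2) - 1))) \<and>
    (\<exists>M :: nat fmap. fmap_wf M \<and> polytopal M \<and> reflexible M \<and> orientable M \<and>
        skeleton_is M ({0..<n} \<times> {0..<m}) (lexcyc_adj n m) \<and>
        map_type M n (2 * m) \<and>
        euler_char M = 2 - 2 * (1 + int m * (int n * ((int m - 1) div 2) - int m))) \<and>
    (\<exists>M :: nat fmap. fmap_wf M \<and> polytopal M \<and> reflexible M \<and> \<not> orientable M \<and>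
        skeleton_is M ({0..<n} \<times> {0..<m}) (lexcyc_adj n m) \<and>
        map_type M (2 * n) (2 * m) \<and>
        euler_char M = 2 - (2 + int m * (int n * (int m - 1) - int m)))"
proof -
  have "n \<ge> 1 * 3" unfolding assms(5) by (rule mult_le_mono) (use assms in auto)
  then have n3: "int n \<ge> 3" by simp
  have m3: "int m \<ge> 3" and oddm: "odd (int m)" and mn: "int m dvd int n" using assms by simp_all
  obtain h where h: "int m = 2 * h + 1" using oddm by (rule oddE)
  interpret C: twisted_map "int n" "int m" 2 1 True by (rule twisted_map_2[OF n3 m3 oddm mn])
  interpret R: twisted_map "int n" "int m" 2 0 True by (rule twisted_map_2[OF n3 m3 oddm mn])
  \<comment> \<open>\<open>h + 1\<close> is the inverse of 2 modulo \<open>m\<close>\<close>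
  have "\<exists>t d. twisted_map (int n) (int m) t 0 False \<and> int m dvd (2 - t) * d - 1"
  proof (cases "odd n")
    case True
    \<comment> \<open>The inverse of 4 is the square of the inverse of 2.\<close>
    have "(2 - (- 2)) * (h + 1)\<^sup>2 - 1 = int m * (int m + 2)" unfolding h by (simp add: power2_eq_square algebra_simps)
    then have "int m dvd (2 - (- 2)) * (h + 1)\<^sup>2 - 1" by simp
    moreover have "odd (int n)" using True by simp
    ultimately show ?thesis using twisted_map_minus_2[OF n3 m3 oddm mn] by blast
  next
    case False
    \<comment> \<open>As \<open>m\<close> is odd, \<open>n\<close> and \<open>s\<close> have the
      same parity, and since 4 does not divide \<open>s\<close>, half of \<open>n\<close> is
      odd.\<close>
    then have "even s" using assms(3,5) by simp
    then obtain r where r: "s = 2 * r" by (rule evenE)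
    then have "odd r" using assms(2) by auto
    then have "int n = 2 * int (r * m)" "odd (int (r * m))" using r assms(3,5) by simp_all
    then have "twisted_map (int n) (int m) 0 0 False" by (rule twisted_map_0[OF n3 m3 oddm])
    moreover have "(2 - 0) * (h + 1) - 1 = int m" using h by simp
    then have "int m dvd (2 - 0) * (h + 1) - 1" by (simp only: dvd_refl)
    ultimately show ?thesis by blast
  qed
  then obtain t d where N: "twisted_map (int n) (int m) t 0 False" and d: "int m dvd (2 - t) * d - 1" by blast
  interpret N: twisted_map "int n" "int m" t 0 False by (rule N)
  have half: "(int m - 1) div 2 = h" using h by simp
  note C = C.chiral_map[OF refl TrueI refl mn] C.wfM C.skeletonM
  note R = R.orientable_map[OF refl TrueI refl mn] R.wfM R.skeletonM
  have not_False: "\<not> False" by simp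
  note N = N.nonorientable_map[OF not_False d] N.wfM N.skeletonM
  show ?thesis
  proof (intro conjI exI)
    show "fmap_wf C.M" "polytopal C.M" "chiral C.M" "map_type C.M (m * n) (2 * m)"
      "skeleton_is C.M ({0..<n} \<times> {0..<m}) (lexcyc_adj n m)"
      using C by simp_all
    show "euler_char C.M = 2 - 2 * (1 + int m * (int n * ((int m - 1) div 2) - 1))"
      unfolding C(4) half unfolding h by (simp add: algebra_simps)
    show "fmap_wf R.M" "polytopal R.M" "reflexible R.M" "orientable R.M" "map_type R.M n (2 * m)"
      "skeleton_is R.M ({0..<n} \<times> {0..<m}) (lexcyc_adj n m)"
      using R by simp_all
    show "euler_char R.M = 2 - 2 * (1 + int m * (int n * ((int m - 1) div 2) - int m))"
      unfolding R(5) half unfolding h by (simp add: algebra_simps)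
    show "fmap_wf N.M" "polytopal N.M" "reflexible N.M" "\<not> orientable N.M" "map_type N.M (2 * n) (2 * m)"
      "skeleton_is N.M ({0..<n} \<times> {0..<m}) (lexcyc_adj n m)"
      using N by simp_all
    show "euler_char N.M = 2 - (2 + int m * (int n * (int m - 1) - int m))"
      unfolding N(5) by (simp add: algebra_simps)
  qed
qed

end
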